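(* Let $m,n\ge 2$ be integers, let $\Omega\subset\mathbb{R}^n$ be a bounded domain with Lipschitz boundary, let $L\in\mathbb{M}^{m\times n}\setminus\{0\}$, and let $\mathcal{L}(\xi)=\sum_{i,j}L_{ij}\xi_{ij}$ for $\xi\in\mathbb{M}^{m\times n}$. Suppose $\eta\in\mathbb{M}^{m\times n}$, $|\eta|<1$, $\gamma\in\mathbb{R}^m$, $(a,b)\in\mathbb{R}^m\times\mathbb{R}^n$, $a\ne 0$, $Lb\neq 0$, $\mathcal{L}(a\otimes b)=0$ and $\epsilon>0$. Let $v_{\eta,\gamma}(x):=\eta x+\gamma$ for $x\in\Omega$, let $t:=\mathcal{L}(\eta)$, and let $s^+>0>s^-$ be the unique numbers such that, with $\eta^\pm_{a\otimes b}:=\eta+s^\pm a\otimes b$, one has $|\eta^\pm_{a\otimes b}|=1$. Then there are infinitely many maps $u\in W^{1,\infty}(\Omega;\mathbb{R}^m)$ satisfying $$\begin{cases}|\nabla u|=1 & \text{a.e. in }\Omega,\\ \mathcal{L}(\nabla u)=t & \text{a.e. in }\Omega,\\ \operatorname{dist}(\nabla u,\{\eta^+_{a\otimes b},\eta^-_{a\otimes b}\})<\epsilon & \text{a.e. in }\Omega,\\ u=v_{\eta,\gamma} & \text{on }\partial\Omega,\\ \|u-v_{\eta,\gamma}\|_{L^\infty(\Omega)}<\epsilon. & \end{cases}$$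
   Context: $\mathbb{M}^{m\times n}$ is the space of real $m\times n$ matrices; $|\xi|=(\sum_{i,j}\xi_{ij}^2)^{1/2}$ is the Hilbert–Schmidt norm, with respect to which $\operatorname{dist}$ is taken; $a\otimes b=(a_ib_j)$. $L$ also acts as the linear map $b\mapsto Lb$ from $\mathbb{R}^n$ to $\mathbb{R}^m$. $\nabla u$ is the $m\times n$ matrix with entries $\partial u^i/\partial x_j$. "$u=v$ on $\partial\Omega$" means $u\in v+W^{1,\infty}_0(\Omega;\mathbb{R}^m)$. *)

theory Defs
  imports "HOL-Analysis.Analysis" "HOL-Probability.Essential_Supremum"
begin

text \<open>
  Matrices with m rows and n columns are elements of \<open>real^'n^'m\<close>; the library norm on this
  type (the Euclidean norm of the vector of Euclidean norms of the rows) is the Hilbert-Schmidt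
  norm, and \<open>dist\<close> and \<open>infdist\<close> are taken with respect to it.
\<close>

definition tensor :: "real^'m \<Rightarrow> real^'n \<Rightarrow> real^'n^'m" where
  "tensor a b = (\<chi> i j. a $ i * b $ j)"

definition lin_fun :: "real^'n^'m \<Rightarrow> real^'n^'m \<Rightarrow> real" where
  "lin_fun L \<xi> = (\<Sum>i\<in>UNIV. \<Sum>j\<in>UNIV. L $ i $ j * \<xi> $ i $ j)"

definition bounded_domain :: "(real^'n) set \<Rightarrow> bool" where
  "bounded_domain \<Omega> \<longleftrightarrow> open \<Omega> \<and> connected \<Omega> \<and> \<Omega> \<noteq> {} \<and> bounded \<Omega>"

text \<open>
  Near each boundary point, \<open>\<Omega>\<close> is the strict supergraph of a Lipschitz function. The choice of
  rotated coordinates is expressed by the unit vector \<open>\<nu>\<close> of the vertical axis: \<open>x \<bullet> \<nu>\<close> is the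
  height of \<open>x\<close>, and \<open>x - (x \<bullet> \<nu>) \<nu>\<close> its projection to the horizontal hyperplane.
\<close>

definition lipschitz_boundary :: "(real^'n) set \<Rightarrow> bool" where
  "lipschitz_boundary \<Omega> \<longleftrightarrow>
     (\<forall>p\<in>frontier \<Omega>. \<exists>r>0. \<exists>\<nu> g C. norm \<nu> = 1 \<and> C-lipschitz_on {y. y \<bullet> \<nu> = 0} g \<and>
        (\<forall>x\<in>ball p r. x \<in> \<Omega> \<longleftrightarrow> g (x - (x \<bullet> \<nu>) *\<^sub>R \<nu>) < x \<bullet> \<nu>))"

subsection \<open>Test functions\<close>

definition partial_deriv ::
    "'n::finite \<Rightarrow> (real^'n \<Rightarrow> 'b::real_normed_vector) \<Rightarrow> real^'n \<Rightarrow> 'b" where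
  "partial_deriv j f x = frechet_derivative f (at x) (axis j 1)"

primrec class_C :: "nat \<Rightarrow> (real^'n::finite \<Rightarrow> 'b::real_normed_vector) \<Rightarrow> bool" where
  "class_C 0 f \<longleftrightarrow> continuous_on UNIV f"
| "class_C (Suc k) f \<longleftrightarrow>
     (\<forall>x. f differentiable (at x)) \<and> (\<forall>j. class_C k (partial_deriv j f))"

text \<open>
  Compactly supported functions on \<open>\<Omega>\<close>, extended by zero to the whole space.
\<close>

definition Cc :: "nat \<Rightarrow> (real^'n) set \<Rightarrow> (real^'n \<Rightarrow> 'b::real_normed_vector) set" where
  "Cc k \<Omega> = {\<phi>. class_C k \<phi> \<and> (\<exists>K. compact K \<and> K \<subseteq> \<Omega> \<and> (\<forall>x. x \<notin> K \<longrightarrow> \<phi> x = 0))}"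

definition Cc_inf :: "(real^'n) set \<Rightarrow> (real^'n \<Rightarrow> 'b::real_normed_vector) set" where
  "Cc_inf \<Omega> = (\<Inter>k. Cc k \<Omega>)"

subsection \<open>Lebesgue and Sobolev spaces\<close>

text \<open>
  Elements of function spaces over \<open>\<Omega>\<close> are represented by functions on the whole space of which
  only the values on \<open>\<Omega>\<close> matter; \<open>ae_equal \<Omega>\<close> identifies functions agreeing almost everywhere
  on \<open>\<Omega>\<close>, so that the elements of the usual spaces are the equivalence classes.
\<close>

definition ae_equal :: "(real^'n) set \<Rightarrow> ((real^'n \<Rightarrow> 'b) \<times> (real^'n \<Rightarrow> 'b)) set" where
  "ae_equal \<Omega> = {(u, v). AE x in lebesgue_on \<Omega>. u x = v x}"

definition Linf_norm :: "(real^'n) set \<Rightarrow> (real^'n \<Rightarrow> 'b::real_normed_vector) \<Rightarrow> ereal" where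
  "Linf_norm \<Omega> f = esssup (lebesgue_on \<Omega>) (\<lambda>x. ereal (norm (f x)))"

definition Linf :: "(real^'n) set \<Rightarrow> (real^'n \<Rightarrow> 'b::real_normed_vector) set" where
  "Linf \<Omega> = {f. f \<in> borel_measurable (lebesgue_on \<Omega>) \<and> Linf_norm \<Omega> f < \<infinity>}"

definition locally_integrable ::
    "(real^'n) set \<Rightarrow> (real^'n \<Rightarrow> 'b::euclidean_space) \<Rightarrow> bool" where
  "locally_integrable \<Omega> f \<longleftrightarrow> (\<forall>K. compact K \<and> K \<subseteq> \<Omega> \<longrightarrow> integrable (lebesgue_on K) f)"

text \<open>
  \<open>weak_gradient \<Omega> u G\<close>: the matrix field \<open>G\<close> is a version of the distributional gradient of \<open>u\<close>
  in \<open>\<Omega>\<close>. It is determined by \<open>u\<close> up to equality almost everywhere in \<open>\<Omega>\<close>.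
\<close>

definition weak_gradient ::
    "(real^'n) set \<Rightarrow> (real^'n \<Rightarrow> real^'m) \<Rightarrow> (real^'n \<Rightarrow> real^'n^'m) \<Rightarrow> bool" where
  "weak_gradient \<Omega> u G \<longleftrightarrow> locally_integrable \<Omega> u \<and> locally_integrable \<Omega> G \<and>
     (\<forall>\<phi> :: real^'n \<Rightarrow> real. \<phi> \<in> Cc_inf \<Omega> \<longrightarrow> (\<forall>i j.
        (LINT x|lebesgue_on \<Omega>. u x $ i * partial_deriv j \<phi> x) =
        - (LINT x|lebesgue_on \<Omega>. G x $ i $ j * \<phi> x)))"

definition W1_inf :: "(real^'n) set \<Rightarrow> (real^'n \<Rightarrow> real^'m) set" where
  "W1_inf \<Omega> = {u. u \<in> Linf \<Omega> \<and> (\<exists>G. weak_gradient \<Omega> u G \<and> G \<in> Linf \<Omega>)}"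

text \<open>
  The closure of compactly supported C1 functions in the norm of \<open>W\<^sup>1\<^sup>,\<^sup>1(\<Omega>)\<close>.
\<close>

definition W1_1_0 :: "(real^'n) set \<Rightarrow> (real^'n \<Rightarrow> real^'m) set" where
  "W1_1_0 \<Omega> = {w. integrable (lebesgue_on \<Omega>) w \<and>
     (\<exists>G. weak_gradient \<Omega> w G \<and> integrable (lebesgue_on \<Omega>) G \<and>
        (\<exists>\<phi>. (\<forall>k::nat. \<phi> k \<in> Cc 1 \<Omega>) \<and>
           (\<lambda>k. LINT x|lebesgue_on \<Omega>. norm (\<phi> k x - w x)) \<longlonglongrightarrow> 0 \<and>
           (\<lambda>k. LINT x|lebesgue_on \<Omega>. norm (jacobian (\<phi> k) (at x) - G x)) \<longlonglongrightarrow> 0))}"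

text \<open>
  The usual convention \<open>W\<^sub>0\<^sup>1\<^sup>,\<^sup>\<infinity> = W\<^sup>1\<^sup>,\<^sup>\<infinity> \<inter> W\<^sub>0\<^sup>1\<^sup>,\<^sup>1\<close>. The closure of test functions in the norm of
  \<open>W\<^sup>1\<^sup>,\<^sup>\<infinity>\<close> would be a different, much smaller space, containing only C1 functions.
\<close>

definition W1_inf_0 :: "(real^'n) set \<Rightarrow> (real^'n \<Rightarrow> real^'m) set" where
  "W1_inf_0 \<Omega> = W1_inf \<Omega> \<inter> W1_1_0 \<Omega>"

definition eq_on_boundary ::
    "(real^'n) set \<Rightarrow> (real^'n \<Rightarrow> real^'m) \<Rightarrow> (real^'n \<Rightarrow> real^'m) \<Rightarrow> bool" where
  "eq_on_boundary \<Omega> u v \<longleftrightarrow> (\<lambda>x. u x - v x) \<in> W1_inf_0 \<Omega>"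

end

(*
  Write A = a \<otimes> b and look for u = v + w. Because L(A) = 0 and Lb \<noteq> 0, the field
  z = (p . grad \<psi>) a - (q . grad \<psi>) Lb with p = L^T L b and q = L^T a satisfies L(Dz) = 0 for every
  scalar \<psi>. For \<psi> = N^-2 S(x) cos(N b.x) / |Lb|^2 one gets Dz = - S cos(N b.x) A + O(1/N) and
  z = O(1/N). Starting from a smooth compactly supported w with |\<eta> + Dw| < 1, such waves with amplitude
  S proportional to \<chi> (1 - |\<eta> + Dw|^2), \<chi> a cutoff, are added repeatedly; the strict inequality is
  preserved and the gradients stay close to the line \<eta> + R A. Each perturbation is so small in the
  supremum norm that, integrating by parts, its gradient is almost orthogonal in L^2 to all previous
  gradients. Hence the energies converge, the gradients are Cauchy in L^2, and the integrals of
  \<chi>^2 (1 - |\<eta> + Dw|^2)^2 tend to zero, so the limit gradient has norm 1 almost everywhere. On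
  the unit sphere, being close to the line means being close to one of its two points on the sphere.
  Starting the iteration from different small multiples of a fixed perturbation yields infinitely
  many solutions.
*)
theory Submission
  imports Defs
begin

subsection \<open>Smooth functions\<close>

text \<open>Two obstacles shape the proof. Multiplying a finished laminate by a cutoff would destroy
  L(Du) = t, since the derivative of the cutoff produces gradients outside the kernel of L. The
  cutoff is therefore placed inside the scalar function on which a second-order operator acts; the
  constraint then follows from the symmetry of mixed derivatives alone, and compact support is
  preserved. The choice of p and q is dictated by p . b = |Lb|^2, which is nonzero, and q . b = L(a
  \<otimes> b) = 0: the terms of order N^2 point along A only. Secondly, uniform convergence of maps
  with bounded gradients yields only weak convergence of the gradients, and the unit sphere is not
  closed under weak limits. Strong convergence is bought by the order of choices: the size of the
  next perturbation is fixed once the second derivatives of the current map are known, however large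
  they are.\<close>

lemma partial_deriv_eq:
  "(f has_derivative f') (at x) \<Longrightarrow> partial_deriv j f x = f' (axis j 1)"
  unfolding partial_deriv_def by (metis frechet_derivative_at)

lemma class_C_Suc_imp: "class_C (Suc k) f \<Longrightarrow> class_C k f"
proof (induction k arbitrary: f)
  case 0
  then show ?case
    by (auto intro!: differentiable_imp_continuous_on simp: differentiable_on_def
        intro: differentiable_at_withinI)
next
  case (Suc k)
  then show ?case by (metis class_C.simps(2))
qed

lemma class_C_const [simp]: "class_C k ((\<lambda>x. c) :: real^'n::finite \<Rightarrow> 'b::real_normed_vector)"
proof (induction k arbitrary: c)
  case (Suc k)
  have "partial_deriv j (\<lambda>x. c) = (\<lambda>x. 0)" for j :: 'n and c :: 'b
    by (rule ext, subst partial_deriv_eq[OF has_derivative_const]) simp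
  with Suc show ?case by simp
qed simp

lemma class_C_add: "class_C k f \<Longrightarrow> class_C k g \<Longrightarrow> class_C k (\<lambda>x. f x + g x)"
proof (induction k arbitrary: f g)
  case 0
  then show ?case by (auto intro: continuous_intros)
next
  case (Suc k)
  have "partial_deriv j (\<lambda>x. f x + g x) = (\<lambda>x. partial_deriv j f x + partial_deriv j g x)" for j
    using Suc.prems
    by (intro ext, subst partial_deriv_eq[OF has_derivative_add])
      (auto simp: frechet_derivative_works[symmetric] partial_deriv_def)
  with Suc show ?case by auto
qed

lemma (in bounded_linear) class_C: "class_C k g \<Longrightarrow> class_C k (\<lambda>x. f (g x))"
proof (induction k arbitrary: g)
  case 0
  then show ?case by (auto intro: continuous_on)
next
  case (Suc k)
  have d: "((\<lambda>x. f (g x)) has_derivative (\<lambda>h. f (frechet_derivative g (at x) h))) (at x)" for x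
    using Suc.prems by (intro has_derivative) (auto simp: frechet_derivative_works[symmetric])
  have "partial_deriv j (\<lambda>x. f (g x)) = (\<lambda>x. f (partial_deriv j g x))" for j
    by (intro ext, subst partial_deriv_eq[OF d]) (auto simp: partial_deriv_def)
  with Suc d show ?case by (auto simp: differentiable_def)
qed

text \<open>One product rule serves real products, scalar multiples and inner products. Each of its
  terms keeps one factor undifferentiated, so the induction also needs that one order of
  differentiability may be dropped.\<close>

lemma (in bounded_bilinear) class_C:
  "class_C k f \<Longrightarrow> class_C k g \<Longrightarrow> class_C k (\<lambda>x. prod (f x) (g x))"
proof (induction k arbitrary: f g)
  case 0
  then show ?case by (auto intro: continuous_on)
next
  case (Suc k)
  have d: "((\<lambda>x. prod (f x) (g x)) has_derivative
      (\<lambda>h. prod (f x) (frechet_derivative g (at x) h) + prod (frechet_derivative f (at x) h) (g x))) (at x)" for x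
    using Suc.prems by (intro FDERIV) (auto simp: frechet_derivative_works[symmetric])
  have "partial_deriv j (\<lambda>x. prod (f x) (g x)) =
      (\<lambda>x. prod (f x) (partial_deriv j g x) + prod (partial_deriv j f x) (g x))" for j
    by (intro ext, subst partial_deriv_eq[OF d]) (auto simp: partial_deriv_def)
  moreover have "class_C k f" "class_C k g"
    using Suc.prems class_C_Suc_imp by blast+
  moreover have "(\<lambda>x. prod (f x) (g x)) differentiable (at x)" for x
    using d differentiable_def by blast
  ultimately show ?case using Suc by (auto intro!: class_C_add)
qed

definition smooth :: "(real^'n::finite \<Rightarrow> 'b::real_normed_vector) \<Rightarrow> bool" where
  "smooth f \<longleftrightarrow> (\<forall>k. class_C k f)"

lemma smooth_const [simp]: "smooth (\<lambda>x. c)"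
  by (simp add: smooth_def)

lemma smooth_add: "smooth f \<Longrightarrow> smooth g \<Longrightarrow> smooth (\<lambda>x. f x + g x)"
  by (simp add: smooth_def class_C_add)

lemma smooth_linear: "bounded_linear T \<Longrightarrow> smooth f \<Longrightarrow> smooth (\<lambda>x. T (f x))"
  by (simp add: smooth_def bounded_linear.class_C)

lemmas smooth_minus = smooth_linear[OF bounded_linear_minus[OF bounded_linear_ident]]

lemma smooth_diff: "smooth f \<Longrightarrow> smooth g \<Longrightarrow> smooth (\<lambda>x. f x - g x)"
  using smooth_add[of f "\<lambda>x. - g x"] smooth_minus[of g] by simp

lemma smooth_sum: "(\<And>i. i \<in> I \<Longrightarrow> smooth (f i)) \<Longrightarrow> smooth (\<lambda>x. \<Sum>i\<in>I. f i x)"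
  by (induction I rule: infinite_finite_induct) (auto intro: smooth_add)

lemma smooth_inner: "smooth f \<Longrightarrow> smooth g \<Longrightarrow> smooth (\<lambda>x. f x \<bullet> g x)"
  by (simp add: smooth_def bounded_bilinear.class_C[OF bounded_bilinear_inner])

lemma smooth_scaleR: "smooth f \<Longrightarrow> smooth g \<Longrightarrow> smooth (\<lambda>x. f x *\<^sub>R g x)"
  by (simp add: smooth_def bounded_bilinear.class_C[OF bounded_bilinear_scaleR])

lemma smooth_mult:
  fixes f g :: "real^'n \<Rightarrow> real"
  shows "smooth f \<Longrightarrow> smooth g \<Longrightarrow> smooth (\<lambda>x. f x * g x)"
  using smooth_scaleR[of f g] by simp

lemma smooth_partial_deriv: "smooth f \<Longrightarrow> smooth (partial_deriv j f)"
  unfolding smooth_def by (metis class_C.simps(2))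

lemma smooth_imp_differentiable: "smooth f \<Longrightarrow> f differentiable (at x)"
  unfolding smooth_def by (metis class_C.simps(2))

lemma smooth_imp_continuous_on: "smooth f \<Longrightarrow> continuous_on S f"
  unfolding smooth_def by (metis class_C.simps(1) continuous_on_subset subset_UNIV)

lemma smooth_has_derivative:
  "smooth f \<Longrightarrow> (f has_derivative frechet_derivative f (at x)) (at x)"
  using smooth_imp_differentiable frechet_derivative_works by blast

lemma smooth_ident: "smooth (\<lambda>x. x)"
proof -
  have "class_C k (\<lambda>x. x :: real^'n)" for k
  proof (cases k)
    case (Suc l)
    have "partial_deriv j (\<lambda>x. x) = (\<lambda>x. axis j 1 :: real^'n)" for j
      by (rule ext, subst partial_deriv_eq[OF has_derivative_ident]) simp
    then show ?thesis by (simp add: Suc)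
  qed simp
  then show ?thesis unfolding smooth_def by blast
qed

text \<open>A derivative of the wave is a multiple of the same wave with its phase advanced by
  \<pi>/2. With the phase left arbitrary the family is closed under differentiation, and sine needs
  no separate treatment.\<close>

lemma smooth_plane_wave: "smooth (\<lambda>x. cos (c \<bullet> x + \<theta>))"
proof -
  have "class_C k (\<lambda>x. cos (c \<bullet> x + \<theta>))" for k
  proof (induction k arbitrary: \<theta>)
    case 0
    show ?case by (auto intro!: continuous_intros)
  next
    case (Suc k)
    have d: "((\<lambda>x. cos (c \<bullet> x + \<theta>)) has_derivative (\<lambda>h. cos (c \<bullet> x + (\<theta> + pi/2)) * (c \<bullet> h))) (at x)" for x
      by (auto intro!: derivative_eq_intros simp: cos_add sin_add algebra_simps)
    have "partial_deriv j (\<lambda>x. cos (c \<bullet> x + \<theta>)) = (\<lambda>x. (c $ j) *\<^sub>R cos (c \<bullet> x + (\<theta> + pi/2)))" for j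
      by (intro ext, subst partial_deriv_eq[OF d]) (auto simp: inner_axis)
    moreover have "class_C k (\<lambda>x. (c $ j) *\<^sub>R cos (c \<bullet> x + (\<theta> + pi/2)))" for j
      by (intro bounded_linear.class_C[OF bounded_linear_scaleR_right] Suc)
    ultimately show ?case using d by (auto simp: differentiable_def)
  qed
  then show ?thesis by (simp add: smooth_def)
qed

section \<open>A smooth function vanishing to infinite order\<close>

text \<open>For \<open>n = 0\<close> this is the classical smooth function that is not analytic at
  0. The extra power of s makes the family closed under differentiation, so that smoothness becomes
  an induction over all \<open>n\<close> at once.\<close>

definition flat :: "nat \<Rightarrow> real \<Rightarrow> real" where
  "flat n s = (if s > 0 then exp (- 1 / s) / s ^ n else 0)"

lemma flat_deriv: "(flat n has_real_derivative flat (n + 2) s - n * flat (n + 1) s) (at s)"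
proof -
  consider "s > 0" | "s < 0" | "s = 0" by linarith
  then show ?thesis
  proof cases
    case 1
    have "((\<lambda>s. exp (- 1 / s) / s ^ n) has_real_derivative flat (n + 2) s - n * flat (n + 1) s) (at s)"
    proof -
      have e: "((\<lambda>s. exp (- 1 / s)) has_real_derivative exp (- 1 / s) * (inverse s)\<^sup>2) (at s)"
        using 1 by (auto intro!: derivative_eq_intros simp: field_simps power2_eq_square)
      have i: "((\<lambda>s. inverse s ^ n) has_real_derivative n * (- ((inverse s)\<^sup>2) * inverse s ^ (n - 1))) (at s)"
        using DERIV_power[OF DERIV_inverse, of s n] 1 by (simp add: power2_eq_square)
      have "((\<lambda>s. exp (- 1 / s) * inverse s ^ n) has_real_derivative
          exp (- 1 / s) * (inverse s)\<^sup>2 * inverse s ^ n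
            - exp (- 1 / s) * (n * inverse s ^ (n - 1) * (inverse s)\<^sup>2)) (at s)"
        by (rule DERIV_cong[OF DERIV_mult[OF e i]]) (simp add: algebra_simps)
      also have "exp (- 1 / s) * (inverse s)\<^sup>2 * inverse s ^ n
            - exp (- 1 / s) * (n * inverse s ^ (n - 1) * (inverse s)\<^sup>2)
          = flat (n + 2) s - n * flat (n + 1) s"
        using 1 by (cases n) (auto simp: flat_def field_simps power2_eq_square)
      finally show ?thesis
        by (simp add: field_simps)
    qed
    then show ?thesis
      by (rule has_field_derivative_transform_within_open[where S = "{0<..}"])
        (use 1 in \<open>auto simp: flat_def\<close>)
  next
    case 2
    have "((\<lambda>s. 0) has_real_derivative flat (n + 2) s - n * flat (n + 1) s) (at s)"
      using 2 by (auto simp: flat_def)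
    then show ?thesis
      by (rule has_field_derivative_transform_within_open[where S = "{..<0}"])
        (use 2 in \<open>auto simp: flat_def\<close>)
  next
    case 3
    \<comment> \<open>With y = 1/s the difference quotient at 0 from the right is y^(n+1) exp(-y),
      which tends to 0 as y grows; from the left it vanishes.\<close>
    have "((\<lambda>s. inverse s ^ Suc n / exp (inverse s)) \<longlongrightarrow> (0::real)) (at_right 0)"
      by (rule filterlim_compose[OF tendsto_power_div_exp_0 filterlim_inverse_at_top_right])
    then have r: "((\<lambda>s. flat n s / s) \<longlongrightarrow> 0) (at_right 0)"
      by (rule Lim_transform_eventually) (auto simp: flat_def eventually_at_filter exp_minus field_simps)
    have l: "((\<lambda>s. flat n s / s) \<longlongrightarrow> 0) (at_left 0)"
      by (rule Lim_transform_eventually[OF tendsto_const]) (auto simp: flat_def eventually_at_filter)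
    have "((\<lambda>s. flat n s / s) \<longlongrightarrow> 0) (at 0)"
      using l r by (rule filterlim_split_at)
    then show ?thesis
      using 3 by (simp add: has_field_derivative_iff flat_def)
  qed
qed

lemma smooth_flat:
  assumes "smooth f" shows "smooth (\<lambda>x. flat n (f x))"
proof -
  have "class_C k (\<lambda>x. flat n (f x))" for k
  proof (induction k arbitrary: n)
    case 0
    have "continuous_on UNIV (flat n)" for n
      using DERIV_isCont[OF flat_deriv] by (auto simp: continuous_on_eq_continuous_at)
    with assms show ?case
      by (auto intro: continuous_on_compose2 smooth_imp_continuous_on)
  next
    case (Suc k)
    have d: "((\<lambda>x. flat n (f x)) has_derivative
       (\<lambda>h. (flat (n + 2) (f x) - n * flat (n + 1) (f x)) * frechet_derivative f (at x) h)) (at x)" for x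
      using has_derivative_compose[OF smooth_has_derivative[OF assms]
          flat_deriv[unfolded has_field_derivative_def]] .
    have "partial_deriv j (\<lambda>x. flat n (f x)) =
      (\<lambda>x. (flat (n + 2) (f x) - n *\<^sub>R flat (n + 1) (f x)) *\<^sub>R partial_deriv j f x)" for j
      by (intro ext, subst partial_deriv_eq[OF d]) (auto simp: partial_deriv_def)
    moreover have "class_C k (\<lambda>x. (flat (n + 2) (f x) - n *\<^sub>R flat (n + 1) (f x)) *\<^sub>R partial_deriv j f x)" for j
      using smooth_partial_deriv[OF assms, of j]
        Suc class_C_add[of k "\<lambda>x. flat (n+2) (f x)" "\<lambda>x. - (n *\<^sub>R flat (n + 1) (f x))"]
        bounded_linear.class_C[OF bounded_linear_minus[OF bounded_linear_scaleR_right], of k "\<lambda>x. flat (n+1) (f x)" n]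
      by (intro bounded_bilinear.class_C[OF bounded_bilinear_scaleR]) (auto simp: smooth_def)
    ultimately show ?case using d by (auto simp: differentiable_def)
  qed
  then show ?thesis by (simp add: smooth_def)
qed

subsection \<open>Gradients, Jacobians and integration by parts\<close>

lemma frechet_derivative_eq_sum:
  assumes "f differentiable (at x)"
  shows "frechet_derivative f (at x) h = (\<Sum>j\<in>UNIV. h $ j *\<^sub>R partial_deriv j f x)"
proof -
  have l: "linear (frechet_derivative f (at x))"
    using assms by (simp add: frechet_derivative_works has_derivative_linear)
  have "frechet_derivative f (at x) h = frechet_derivative f (at x) (\<Sum>j\<in>UNIV. h $ j *\<^sub>R axis j 1)"
    by (simp add: basis_expansion flip: scalar_mult_eq_scaleR)
  also have "\<dots> = (\<Sum>j\<in>UNIV. h $ j *\<^sub>R partial_deriv j f x)"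
    by (simp add: linear_sum[OF l] linear_cmul[OF l] partial_deriv_def)
  finally show ?thesis .
qed

definition grad :: "(real^'n \<Rightarrow> real) \<Rightarrow> real^'n \<Rightarrow> real^'n" where
  "grad f x = (\<chi> j. partial_deriv j f x)"

lemma grad_eq: "(f has_derivative (\<lambda>h. g \<bullet> h)) (at x) \<Longrightarrow> grad f x = g"
  by (simp add: grad_def vec_eq_iff partial_deriv_eq inner_axis)

lemma has_derivative_grad:
  assumes "smooth f" shows "(f has_derivative (\<lambda>h. grad f x \<bullet> h)) (at x)"
proof -
  have "frechet_derivative f (at x) = (\<lambda>h. grad f x \<bullet> h)"
    using frechet_derivative_eq_sum[OF smooth_imp_differentiable[OF assms]]
    by (auto simp: fun_eq_iff inner_vec_def grad_def mult.commute)
  then show ?thesis using smooth_has_derivative[OF assms, of x] by simp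
qed

lemma smooth_grad:
  assumes "smooth f" shows "smooth (grad f)"
proof -
  have "grad f = (\<lambda>x. \<Sum>j\<in>UNIV. partial_deriv j f x *\<^sub>R axis j 1)"
    by (rule ext) (simp add: grad_def vec_eq_iff axis_def if_distrib cong: if_cong)
  then show ?thesis
    using assms by (auto intro!: smooth_sum smooth_scaleR smooth_partial_deriv)
qed

lemma bounded_bilinear_tensor: "bounded_bilinear (tensor :: real^'m \<Rightarrow> real^'n \<Rightarrow> real^'n^'m)"
  unfolding bilinear_conv_bounded_bilinear[symmetric] bilinear_def
  by (auto intro!: linearI simp: tensor_def vec_eq_iff algebra_simps)

lemma norm_tensor: "norm (tensor a b) = norm a * norm b"
proof -
  have "(norm (tensor a b))\<^sup>2 = (norm a * norm b)\<^sup>2"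
    unfolding power_mult_distrib dot_square_norm[symmetric]
    by (simp add: inner_vec_def tensor_def sum_product algebra_simps) (rule sum.swap)
  then show ?thesis by simp
qed

lemma jacobian_nth: "jacobian w (at x) $ i $ j = partial_deriv j w x $ i"
  by (simp add: jacobian_def matrix_def partial_deriv_def)

lemma smooth_nth: "smooth w \<Longrightarrow> smooth (\<lambda>x. w x $ i)"
  by (rule smooth_linear[OF bounded_linear_vec_nth])

lemma partial_deriv_nth:
  assumes "w differentiable (at x)"
  shows "partial_deriv j (\<lambda>x. w x $ i) x = partial_deriv j w x $ i"
proof -
  have "((\<lambda>x. w x $ i) has_derivative (\<lambda>h. frechet_derivative w (at x) h $ i)) (at x)"
    using assms
    by (intro bounded_linear.has_derivative[OF bounded_linear_vec_nth])
      (simp add: frechet_derivative_works)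
  from partial_deriv_eq[OF this] show ?thesis by (simp add: partial_deriv_def)
qed

lemma smooth_jacobian:
  fixes w :: "real^'n \<Rightarrow> real^'m"
  assumes "smooth w" shows "smooth (\<lambda>x. jacobian w (at x))"
proof -
  have "(\<lambda>x. jacobian w (at x)) = (\<lambda>x. \<Sum>j\<in>UNIV. tensor (partial_deriv j w x) (axis j 1))"
    by (rule ext)
      (simp add: jacobian_nth vec_eq_iff axis_def tensor_def if_distrib cong: if_cong)
  then show ?thesis
    using assms
    by (auto intro!: smooth_sum smooth_partial_deriv
        smooth_linear[OF bounded_bilinear.bounded_linear_left[OF bounded_bilinear_tensor]])
qed

lemma jacobian_add:
  "smooth w \<Longrightarrow> smooth z \<Longrightarrow> jacobian (\<lambda>x. w x + z x) (at x) = jacobian w (at x) + jacobian z (at x)"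
  by (simp add: vec_eq_iff jacobian_nth
      partial_deriv_eq[OF has_derivative_add[OF smooth_has_derivative smooth_has_derivative]])
    (simp add: partial_deriv_def)

lemma jacobian_diff:
  "smooth w \<Longrightarrow> smooth z \<Longrightarrow> jacobian (\<lambda>x. w x - z x) (at x) = jacobian w (at x) - jacobian z (at x)"
  by (simp add: vec_eq_iff jacobian_nth
      partial_deriv_eq[OF has_derivative_diff[OF smooth_has_derivative smooth_has_derivative]])
    (simp add: partial_deriv_def)

lemma jacobian_scaleR:
  assumes "smooth w" shows "jacobian (\<lambda>x. k *\<^sub>R w x) (at x) = k *\<^sub>R jacobian w (at x)"
proof -
  have "((\<lambda>x. k *\<^sub>R w x) has_derivative (\<lambda>h. k *\<^sub>R frechet_derivative w (at x) h)) (at x)"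
    by (intro has_derivative_scaleR_right smooth_has_derivative assms)
  from partial_deriv_eq[OF this] show ?thesis
    by (simp add: vec_eq_iff jacobian_nth) (simp add: partial_deriv_def)
qed

section \<open>Integration by parts for compactly supported functions\<close>

text \<open>Translation invariance gives every difference quotient integral 0, and dominated
  convergence passes this on to the derivative. No iterated integration is involved.\<close>

lemma integral_lborel_partial_deriv:
  fixes f :: "real^'n \<Rightarrow> real"
  assumes f: "class_C 1 f" and K: "compact K" "\<And>x. x \<notin> K \<Longrightarrow> f x = 0"
  shows "integral\<^sup>L lborel (partial_deriv j f) = 0"
proof -
  define e :: "real^'n" where "e = axis j 1"
  define h :: "nat \<Rightarrow> real" where "h k = 1 / (Suc k)" for k
  have h: "0 < h k" "h k \<le> 1" for k by (auto simp: h_def)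
  have ne: "norm e = 1" by (simp add: e_def)
  define d where "d k x = (f (x + h k *\<^sub>R e) - f x) / h k" for k x
  have df: "f differentiable (at x)" for x using f by simp
  have cf: "continuous_on S f" for S
    using class_C_Suc_imp[of 0 f] f continuous_on_subset by auto
  have cp: "continuous_on S (partial_deriv j f)" for S
    using f continuous_on_subset[of UNIV "partial_deriv j f" S] by auto
  have D: "((\<lambda>t. f (x + t *\<^sub>R e)) has_real_derivative partial_deriv j f (x + t *\<^sub>R e)) (at t)" for x t
  proof -
    have "((\<lambda>t. f (x + t *\<^sub>R e)) has_derivative (\<lambda>s. frechet_derivative f (at (x + t *\<^sub>R e)) (s *\<^sub>R e))) (at t)"
      by (rule has_derivative_compose[of "\<lambda>t. x + t *\<^sub>R e" _ t UNIV f])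
        (use df in \<open>auto intro!: derivative_eq_intros simp: frechet_derivative_works\<close>)
    moreover have "frechet_derivative f (at y) (s *\<^sub>R e) = partial_deriv j f y * s" for y s
      using df[of y] linear_cmul[of "frechet_derivative f (at y)"]
      by (simp add: frechet_derivative_works has_derivative_linear partial_deriv_def e_def)
    ultimately show ?thesis by (simp add: has_field_derivative_def)
  qed
  obtain R where R: "K \<subseteq> ball 0 R"
    using compact_imp_bounded[OF K(1)] bounded_subset_ballD by blast
  \<comment> \<open>The shifts satisfy \<open>h k \<le> 1\<close>. For x in the ball of radius R + 1
    the mean value point lies within R + 2; outside that ball both x and its shift miss K and the
    quotient is 0.\<close>
  obtain B where B: "\<And>x. x \<in> cball 0 (R + 2) \<Longrightarrow> \<bar>partial_deriv j f x\<bar> \<le> B"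
    using compact_imp_bounded[OF compact_continuous_image[OF cp compact_cball, of 0 "R + 2"]]
    unfolding bounded_iff by force
  have int_f: "integrable lborel f"
  proof -
    have "integrable lborel (\<lambda>x. indicator K x *\<^sub>R f x)"
      by (rule borel_integrable_compact[OF K(1) cf])
    also have "(\<lambda>x. indicator K x *\<^sub>R f x) = f"
      using K(2) by (intro ext) (auto simp: indicator_def)
    finally show ?thesis .
  qed
  have shift: "integrable lborel (\<lambda>x. f (x + c))" "integral\<^sup>L lborel (\<lambda>x. f (x + c)) = integral\<^sup>L lborel f" for c
    using integrable_distr_eq[of "(+) c" lborel borel f] integral_distr[of "(+) c" lborel borel f] int_f
    by (auto simp: lborel_distr_plus add.commute)
  have int_d: "integral\<^sup>L lborel (d k) = 0" for k
    unfolding d_def using shift int_f by simp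
  have dom: "norm (d k x) \<le> B * indicator (cball 0 (R + 1)) x" for k x
  proof (cases "x \<in> cball 0 (R + 1)")
    case True
    obtain z where z: "0 < z" "z < h k"
      "f (x + h k *\<^sub>R e) - f (x + 0 *\<^sub>R e) = (h k - 0) * partial_deriv j f (x + z *\<^sub>R e)"
      using MVT2[of 0 "h k" "\<lambda>t. f (x + t *\<^sub>R e)", OF h(1) D] by blast
    have "norm (x + z *\<^sub>R e) \<le> R + 2"
      using True z h(2)[of k] norm_triangle_ineq[of x "z *\<^sub>R e"] by (auto simp: ne)
    then have "\<bar>partial_deriv j f (x + z *\<^sub>R e)\<bar> \<le> B" using B by simp
    with z h(1)[of k] True show ?thesis by (simp add: d_def)
  next
    case False
    have "norm x \<le> norm (x + h k *\<^sub>R e) + h k"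
      using norm_triangle_ineq4[of "x + h k *\<^sub>R e" "h k *\<^sub>R e"] h(1)[of k] by (simp add: ne)
    with False h(2)[of k] have "x \<notin> ball 0 R" "x + h k *\<^sub>R e \<notin> ball 0 R" by auto
    with R have "x \<notin> K" "x + h k *\<^sub>R e \<notin> K" by blast+
    with False show ?thesis by (simp add: d_def K(2))
  qed
  have lim: "(\<lambda>k. d k x) \<longlonglongrightarrow> partial_deriv j f x" for x
  proof -
    have "((\<lambda>t. (f (x + t *\<^sub>R e) - f x) / t) \<longlongrightarrow> partial_deriv j f x) (at 0)"
      using D[of x 0] by (simp add: has_field_derivative_iff)
    moreover have "filterlim h (at 0) sequentially"
      unfolding filterlim_at h_def using LIMSEQ_inverse_real_of_nat by (auto simp: inverse_eq_divide)
    ultimately show ?thesis unfolding d_def by (rule filterlim_compose)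
  qed
  have "(\<lambda>k. integral\<^sup>L lborel (d k)) \<longlonglongrightarrow> integral\<^sup>L lborel (partial_deriv j f)"
  proof (rule integral_dominated_convergence[where w = "\<lambda>x. B * indicator (cball 0 (R + 1)) x"])
    show "partial_deriv j f \<in> borel_measurable lborel"
      using borel_measurable_continuous_onI[OF cp] by simp
    show "d k \<in> borel_measurable lborel" for k
      unfolding d_def using shift(1)[of "h k *\<^sub>R e"] int_f by measurable
    show "integrable lborel (\<lambda>x. B * indicator (cball 0 (R + 1)) x :: real)"
      by (intro integrable_mult_right integrable_real_indicator)
        (use emeasure_bounded_finite[OF bounded_cball] in auto)
  qed (use dom lim in auto)
  then show ?thesis by (simp add: int_d LIMSEQ_const_iff)
qed

lemma partial_deriv_eq_0:
  assumes "open U" "x \<in> U" "\<And>y. y \<in> U \<Longrightarrow> f y = 0"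
  shows "partial_deriv j f x = 0"
proof -
  have "(f has_derivative (\<lambda>h. 0)) (at x)"
    by (rule has_derivative_transform_within_open[of "\<lambda>x. 0" _ _ _ U])
      (use assms in \<open>auto intro!: has_derivative_const\<close>)
  then show ?thesis by (simp add: partial_deriv_eq)
qed

lemma integral_partial_deriv_Cc:
  fixes f :: "real^'n \<Rightarrow> real"
  assumes "open \<Omega>" "f \<in> Cc 1 \<Omega>"
  shows "(LINT x|lebesgue_on \<Omega>. partial_deriv j f x) = 0"
proof -
  obtain K where f: "class_C 1 f" and K: "compact K" "K \<subseteq> \<Omega>" "\<And>x. x \<notin> K \<Longrightarrow> f x = 0"
    using assms by (auto simp: Cc_def)
  have z: "partial_deriv j f x = 0" if "x \<notin> \<Omega>" for x
    by (rule partial_deriv_eq_0[of "- K"]) (use K that compact_imp_closed in auto)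
  have "(LINT x|lebesgue_on \<Omega>. partial_deriv j f x) = integral\<^sup>L lebesgue (\<lambda>x. indicator \<Omega> x *\<^sub>R partial_deriv j f x)"
    using assms(1) by (intro integral_restrict_space) auto
  also have "(\<lambda>x. indicator \<Omega> x *\<^sub>R partial_deriv j f x) = partial_deriv j f"
    using z by (intro ext) (auto simp: indicator_def)
  also have "integral\<^sup>L lebesgue (partial_deriv j f) = integral\<^sup>L lborel (partial_deriv j f)"
    using f borel_measurable_continuous_onI[of "partial_deriv j f"] by (intro integral_completion) simp
  also have "\<dots> = 0" by (rule integral_lborel_partial_deriv[OF f K(1,3)])
  finally show ?thesis .
qed

lemma integrable_lebesgue_on_bounded:
  fixes f :: "real^'n \<Rightarrow> 'b::{banach, second_countable_topology}"
  assumes "\<Omega> \<in> lmeasurable" "f \<in> borel_measurable (lebesgue_on \<Omega>)" "\<And>x. x \<in> \<Omega> \<Longrightarrow> norm (f x) \<le> B"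
  shows "integrable (lebesgue_on \<Omega>) f"
  using assms finite_measure_lebesgue_on[OF assms(1)]
  by (intro finite_measure.integrable_const_bound[where B=B]) auto

lemma integrable_continuous_on_bounded:
  fixes f :: "real^'n \<Rightarrow> 'b::{banach, second_countable_topology}"
  assumes "\<Omega> \<in> lmeasurable" "bounded \<Omega>" "continuous_on UNIV f"
  shows "integrable (lebesgue_on \<Omega>) f"
proof -
  obtain R where R: "\<Omega> \<subseteq> cball 0 R"
    using bounded_subset_ballD[OF assms(2)] ball_subset_cball by blast
  have "bounded (f ` cball 0 R)"
    using assms(3) by (intro compact_imp_bounded compact_continuous_image) (auto intro: continuous_on_subset)
  then obtain B where "\<And>x. x \<in> cball 0 R \<Longrightarrow> norm (f x) \<le> B"
    unfolding bounded_iff by force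
  with R show ?thesis
    using assms by (intro integrable_lebesgue_on_bounded[where B=B] continuous_imp_measurable_on_sets_lebesgue)
      (auto intro: continuous_on_subset)
qed

text \<open>The product of \<open>f\<close> and \<open>g\<close> inherits the compact support of
  \<open>g\<close>, so \<open>f\<close> may be nonzero up to the boundary. This matters because it
  is applied to components of affine maps plus perturbations and of their gradients.\<close>

lemma integration_by_parts:
  fixes f g :: "real^'n \<Rightarrow> real"
  assumes "open \<Omega>" "bounded \<Omega>" "class_C 1 f" "g \<in> Cc 1 \<Omega>"
  shows "(LINT x|lebesgue_on \<Omega>. f x * partial_deriv j g x) = - (LINT x|lebesgue_on \<Omega>. partial_deriv j f x * g x)"
proof -
  have g: "class_C 1 g" using assms by (auto simp: Cc_def)
  have m: "\<Omega> \<in> lmeasurable" using assms by (simp add: lmeasurable_open)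
  have c: "class_C 0 f" "class_C 0 g"
    using g assms(3) class_C_Suc_imp by (metis One_nat_def)+
  have "(\<lambda>x. f x * g x) \<in> Cc 1 \<Omega>"
    using assms(4) bounded_bilinear.class_C[OF bounded_bilinear_mult assms(3) g]
    unfolding Cc_def mem_Collect_eq by (metis mult_zero_right)
  then have "(LINT x|lebesgue_on \<Omega>. partial_deriv j (\<lambda>x. f x * g x) x) = 0"
    by (rule integral_partial_deriv_Cc[OF assms(1)])
  also have "partial_deriv j (\<lambda>x. f x * g x) = (\<lambda>x. f x * partial_deriv j g x + partial_deriv j f x * g x)"
  proof
    fix x
    have "((\<lambda>x. f x * g x) has_derivative
      (\<lambda>h. f x * frechet_derivative g (at x) h + frechet_derivative f (at x) h * g x)) (at x)"
      using assms(3) g by (intro has_derivative_mult) (auto simp: frechet_derivative_works)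
    from partial_deriv_eq[OF this] show "partial_deriv j (\<lambda>x. f x * g x) x = f x * partial_deriv j g x + partial_deriv j f x * g x"
      by (simp add: partial_deriv_def)
  qed
  finally show ?thesis
    using c g assms(3) by (subst (asm) Bochner_Integration.integral_add)
      (auto intro!: integrable_continuous_on_bounded m assms(2) continuous_intros)
qed

section \<open>Symmetry of mixed directional derivatives\<close>

lemma DERIV_along_line:
  assumes "smooth f"
  shows "((\<lambda>t. f (x + t *\<^sub>R p)) has_real_derivative p \<bullet> grad f (x + t *\<^sub>R p)) (at t)"
proof -
  have "((\<lambda>t. f (x + t *\<^sub>R p)) has_derivative (\<lambda>s. grad f (x + t *\<^sub>R p) \<bullet> (s *\<^sub>R p))) (at t)"
    by (rule has_derivative_compose[of "\<lambda>t. x + t *\<^sub>R p" _ t UNIV f])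
      (auto intro!: derivative_eq_intros has_derivative_grad assms)
  moreover have "(\<lambda>s. grad f (x + t *\<^sub>R p) \<bullet> (s *\<^sub>R p)) = (*) (p \<bullet> grad f (x + t *\<^sub>R p))"
    by (auto simp: fun_eq_iff inner_commute)
  ultimately show ?thesis by (simp add: has_field_derivative_def)
qed

lemma smooth_directional: "smooth f \<Longrightarrow> smooth (\<lambda>x. p \<bullet> grad f x)"
  by (intro smooth_inner smooth_const smooth_grad)

lemma second_difference:
  assumes f: "smooth f" and h: "h > 0"
  obtains y where "norm (y - x) \<le> h * (norm p + norm q)"
    "f (x + h *\<^sub>R p + h *\<^sub>R q) - f (x + h *\<^sub>R p) - f (x + h *\<^sub>R q) + f x =
      h\<^sup>2 * (q \<bullet> grad (\<lambda>x. p \<bullet> grad f x) y)"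
proof -
  let ?Dp = "\<lambda>x. p \<bullet> grad f x"
  have 1: "((\<lambda>t. f ((x + h *\<^sub>R q) + t *\<^sub>R p) - f (x + t *\<^sub>R p)) has_real_derivative
      ?Dp ((x + h *\<^sub>R q) + t *\<^sub>R p) - ?Dp (x + t *\<^sub>R p)) (at t)" for t
    by (intro DERIV_diff DERIV_along_line f)
  obtain s where s: "0 < s" "s < h"
    "f ((x + h *\<^sub>R q) + h *\<^sub>R p) - f (x + h *\<^sub>R p) - (f ((x + h *\<^sub>R q) + 0 *\<^sub>R p) - f (x + 0 *\<^sub>R p))
     = (h - 0) * (?Dp ((x + h *\<^sub>R q) + s *\<^sub>R p) - ?Dp (x + s *\<^sub>R p))"
    using MVT2[OF h 1] by metis
  obtain t where t: "0 < t" "t < h"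
    "?Dp ((x + s *\<^sub>R p) + h *\<^sub>R q) - ?Dp ((x + s *\<^sub>R p) + 0 *\<^sub>R q)
      = (h - 0) * (q \<bullet> grad ?Dp ((x + s *\<^sub>R p) + t *\<^sub>R q))"
    using MVT2[OF h DERIV_along_line[OF smooth_directional[OF f]]] by metis
  show thesis
  proof (rule that)
    have "norm (x + s *\<^sub>R p + t *\<^sub>R q - x) \<le> s * norm p + t * norm q"
      using norm_triangle_ineq[of "s *\<^sub>R p" "t *\<^sub>R q"] s t by (simp add: algebra_simps)
    also have "\<dots> \<le> h * (norm p + norm q)"
      using s t by (auto simp: distrib_left intro!: add_mono mult_right_mono)
    finally show "norm (x + s *\<^sub>R p + t *\<^sub>R q - x) \<le> h * (norm p + norm q)" .
    have e: "x + h *\<^sub>R q + h *\<^sub>R p = x + h *\<^sub>R p + h *\<^sub>R q" "x + h *\<^sub>R q + s *\<^sub>R p = x + s *\<^sub>R p + h *\<^sub>R q"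
      by simp_all
    show "f (x + h *\<^sub>R p + h *\<^sub>R q) - f (x + h *\<^sub>R p) - f (x + h *\<^sub>R q) + f x =
      h\<^sup>2 * (q \<bullet> grad ?Dp (x + s *\<^sub>R p + t *\<^sub>R q))"
      using s(3) t(3) unfolding e by (simp add: power2_eq_square)
  qed
qed

text \<open>The second difference is unchanged when \<open>p\<close> and \<open>q\<close> are
  swapped, so it equals h^2 times either mixed derivative, each at a point within O(h) of x. Letting
  h tend to 0 identifies the two by continuity. This symmetry is the only source of the constraint
  L(Dz) = 0 later on.\<close>

lemma smooth_mixed_derivatives_commute:
  assumes f: "smooth f"
  shows "q \<bullet> grad (\<lambda>x. p \<bullet> grad f x) x = p \<bullet> grad (\<lambda>x. q \<bullet> grad f x) x"
proof -
  define h :: "nat \<Rightarrow> real" where "h k = inverse (Suc k)" for k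
  let ?F = "\<lambda>p q x. q \<bullet> grad (\<lambda>x. p \<bullet> grad f x) x"
  have h: "h k > 0" for k by (simp add: h_def)
  have hlim: "(\<lambda>k. h k * C) \<longlonglongrightarrow> 0" for C
    unfolding h_def using tendsto_mult_left_zero[OF LIMSEQ_inverse_real_of_nat] .
  have "\<exists>y z. norm (y - x) \<le> h k * (norm p + norm q) \<and> norm (z - x) \<le> h k * (norm p + norm q) \<and> ?F p q y = ?F q p z" for k
  proof -
    obtain y where y: "norm (y - x) \<le> h k * (norm p + norm q)"
      "f (x + h k *\<^sub>R p + h k *\<^sub>R q) - f (x + h k *\<^sub>R p) - f (x + h k *\<^sub>R q) + f x = (h k)\<^sup>2 * ?F p q y"
      using second_difference[OF f h] by metis
    obtain z where z: "norm (z - x) \<le> h k * (norm q + norm p)"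
      "f (x + h k *\<^sub>R q + h k *\<^sub>R p) - f (x + h k *\<^sub>R q) - f (x + h k *\<^sub>R p) + f x = (h k)\<^sup>2 * ?F q p z"
      using second_difference[OF f h] by metis
    have e: "x + h k *\<^sub>R q + h k *\<^sub>R p = x + h k *\<^sub>R p + h k *\<^sub>R q" by simp
    have "(h k)\<^sup>2 * ?F p q y = (h k)\<^sup>2 * ?F q p z"
      using y(2) z(2) unfolding e by linarith
    then show ?thesis using y(1) z(1) h[of k] by (auto simp: add.commute)
  qed
  then obtain y z where yz: "\<And>k. norm (y k - x) \<le> h k * (norm p + norm q)"
    "\<And>k. norm (z k - x) \<le> h k * (norm p + norm q)" "\<And>k. ?F p q (y k) = ?F q p (z k)"
    by metis
  have lim: "y \<longlonglongrightarrow> x" "z \<longlonglongrightarrow> x"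
    using yz by (auto intro!: LIM_zero_cancel[where l = x] Lim_null_comparison[OF _ hlim] always_eventually)
  have c: "isCont (?F p q) x" for p q
    using smooth_imp_continuous_on[OF smooth_directional[OF smooth_directional[OF f]], of UNIV]
    by (simp add: continuous_on_eq_continuous_at)
  have "(\<lambda>k. ?F p q (y k)) \<longlonglongrightarrow> ?F p q x" "(\<lambda>k. ?F q p (z k)) \<longlonglongrightarrow> ?F q p x"
    by (rule isCont_tendsto_compose[OF c lim(1)], rule isCont_tendsto_compose[OF c lim(2)])
  then show ?thesis unfolding yz(3) by (rule LIMSEQ_unique)
qed

subsection \<open>Bump functions and cutoffs\<close>

lemma flat_bounds: "0 \<le> flat 0 s" "flat 0 s \<le> 1"
  by (auto simp: flat_def)

definition bump :: "real^'n \<Rightarrow> real \<Rightarrow> real^'n \<Rightarrow> real" where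
  "bump c r x = flat 0 (r\<^sup>2 - (x - c) \<bullet> (x - c))"

lemma smooth_bump: "smooth (bump c r)"
  unfolding bump_def[abs_def] by (intro smooth_flat smooth_diff smooth_inner smooth_const smooth_ident)

lemma bump_pos: "r > 0 \<Longrightarrow> bump c r x > 0 \<longleftrightarrow> x \<in> ball c r"
  by (auto simp: bump_def flat_def dot_square_norm dist_norm norm_minus_commute power2_less_imp_less
      intro: power_strict_mono)

lemma bump_eq_0: "r > 0 \<Longrightarrow> x \<notin> cball c r \<Longrightarrow> bump c r x = 0"
  using bump_pos[of r c x] flat_bounds(1)[of "r\<^sup>2 - (x - c) \<bullet> (x - c)"]
  by (auto simp: bump_def)

lemma Cc_infI: "smooth f \<Longrightarrow> compact K \<Longrightarrow> K \<subseteq> \<Omega> \<Longrightarrow> (\<And>x. x \<notin> K \<Longrightarrow> f x = 0) \<Longrightarrow> f \<in> Cc_inf \<Omega>"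
  by (auto simp: Cc_inf_def Cc_def smooth_def)

lemma Cc_infE:
  assumes "f \<in> Cc_inf \<Omega>"
  obtains K where "compact K" "K \<subseteq> \<Omega>" "\<And>x. x \<notin> K \<Longrightarrow> f x = 0"
proof -
  have "f \<in> Cc 0 \<Omega>" using assms by (simp add: Cc_inf_def)
  then show thesis using that by (auto simp: Cc_def)
qed

lemma Cc_inf_imp_smooth: "f \<in> Cc_inf \<Omega> \<Longrightarrow> smooth f"
  by (auto simp: Cc_inf_def Cc_def smooth_def)

lemma Cc_inf_imp_Cc: "f \<in> Cc_inf \<Omega> \<Longrightarrow> f \<in> Cc k \<Omega>"
  by (auto simp: Cc_inf_def)

lemma Cc_inf_add: assumes "f \<in> Cc_inf \<Omega>" "g \<in> Cc_inf \<Omega>" shows "(\<lambda>x. f x + g x) \<in> Cc_inf \<Omega>"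
proof -
  obtain K where K: "compact K" "K \<subseteq> \<Omega>" "\<And>x. x \<notin> K \<Longrightarrow> f x = 0" using Cc_infE[OF assms(1)] by metis
  obtain K' where K': "compact K'" "K' \<subseteq> \<Omega>" "\<And>x. x \<notin> K' \<Longrightarrow> g x = 0" using Cc_infE[OF assms(2)] by metis
  show ?thesis
    by (rule Cc_infI[where K = "K \<union> K'"])
      (use K K' assms in \<open>auto intro!: smooth_add dest: Cc_inf_imp_smooth\<close>)
qed

lemma Cc_inf_sum: "finite I \<Longrightarrow> (\<And>i. i \<in> I \<Longrightarrow> f i \<in> Cc_inf \<Omega>) \<Longrightarrow> (\<lambda>x. \<Sum>i\<in>I. f i x) \<in> Cc_inf \<Omega>"
  by (induction I rule: finite_induct)
    (auto intro: Cc_inf_add Cc_infI[where K = "{}"])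

text \<open>A single compactly supported function cannot be positive on all of \<Omega>, so the
  iteration uses a sequence: partial sums of bumps on countably many balls covering \<Omega>. The
  limit need not be 1; its positivity suffices to read off a vanishing defect from a vanishing
  weighted integral.\<close>

lemma smooth_cutoff_sequence:
  fixes \<Omega> :: "(real^'n) set"
  assumes "open \<Omega>" "\<Omega> \<noteq> {}"
  obtains X :: "nat \<Rightarrow> real^'n \<Rightarrow> real" and Y where
    "\<And>k. X k \<in> Cc_inf \<Omega>" "\<And>k x. 0 \<le> X k x" "\<And>k x. X k x \<le> 1"
    "\<And>x. (\<lambda>k. X k x) \<longlonglongrightarrow> Y x" "\<And>x. x \<in> \<Omega> \<Longrightarrow> Y x > 0"
proof -
  define F where "F = {ball c r | c r. r > 0 \<and> cball c r \<subseteq> \<Omega>}"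
  have UF: "\<Union>F = \<Omega>"
  proof
    show "\<Union>F \<subseteq> \<Omega>" unfolding F_def using ball_subset_cball by blast
    show "\<Omega> \<subseteq> \<Union>F"
    proof
      fix x assume "x \<in> \<Omega>"
      then obtain e where "e > 0" "cball x e \<subseteq> \<Omega>"
        using assms(1) open_contains_cball by blast
      then show "x \<in> \<Union>F" unfolding F_def using centre_in_ball by blast
    qed
  qed
  obtain F' where F': "F' \<subseteq> F" "countable F'" "\<Union>F' = \<Omega>"
    using Lindelof[of F] UF unfolding F_def by auto
  have ne: "F' \<noteq> {}" using F'(3) assms(2) by auto
  have "\<exists>c r. from_nat_into F' i = ball c r \<and> r > 0 \<and> cball c r \<subseteq> \<Omega>" for i
    using from_nat_into[OF ne, of i] F'(1) unfolding F_def by blast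
  then obtain c r where cr: "\<And>i. from_nat_into F' i = ball (c i) (r i)" "\<And>i. r i > 0" "\<And>i. cball (c i) (r i) \<subseteq> \<Omega>"
    by metis
  \<comment> \<open>The geometric weights sum to 1 and bumps are at most 1, so all partial sums stay
    below 1 even where many balls overlap.\<close>
  define t where "t i x = (1/2::real) ^ Suc i * bump (c i) (r i) x" for i x
  have t: "0 \<le> t i x" "t i x \<le> (1/2) ^ Suc i" for i x
    using flat_bounds by (auto simp: t_def bump_def)
  have half: "(\<lambda>i. (1/2::real) ^ Suc i) sums 1"
    using power_half_series .
  have sm: "summable (\<lambda>i. t i x)" for x
    by (rule summable_comparison_test'[OF sums_summable[OF half], where N = 0]) (use t in auto)
  show thesis
  proof (rule that)
    fix k x
    have "t i \<in> Cc_inf \<Omega>" for i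
      unfolding t_def[abs_def]
      using cr by (intro Cc_infI[where K = "cball (c i) (r i)"] smooth_mult smooth_const smooth_bump)
        (auto simp: bump_eq_0)
    then show "(\<lambda>x. \<Sum>i<k. t i x) \<in> Cc_inf \<Omega>" by (intro Cc_inf_sum) auto
    show "0 \<le> (\<Sum>i<k. t i x)" using t by (intro sum_nonneg) auto
    have "(\<Sum>i<k. t i x) \<le> (\<Sum>i<k. (1/2) ^ Suc i)" using t by (intro sum_mono)
    also have "\<dots> \<le> (\<Sum>i. (1/2) ^ Suc i)"
      using half by (intro sum_le_suminf) (auto simp: sums_iff)
    finally show "(\<Sum>i<k. t i x) \<le> 1" using half by (simp add: sums_iff)
    show "(\<lambda>k. \<Sum>i<k. t i x) \<longlonglongrightarrow> (\<Sum>i. t i x)"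
      using sm summable_LIMSEQ by blast
  next
    fix x assume "x \<in> \<Omega>"
    then obtain S where S: "S \<in> F'" "x \<in> S" using F'(3) by blast
    then obtain i where "x \<in> ball (c i) (r i)"
      using cr(1) from_nat_into_surj[OF F'(2)] by metis
    then have "t i x > 0" using bump_pos[OF cr(2)] by (auto simp: t_def intro!: mult_pos_pos)
    then show "(\<Sum>i. t i x) > 0" using sm t by (intro suminf_pos2) auto
  qed
qed

lemma Cc_inf_bounded:
  fixes f :: "real^'n \<Rightarrow> 'b::real_normed_vector"
  assumes "f \<in> Cc_inf \<Omega>"
  obtains B where "B \<ge> 0" "\<And>x. norm (f x) \<le> B"
proof -
  obtain K where K: "compact K" "\<And>x. x \<notin> K \<Longrightarrow> f x = 0" using Cc_infE[OF assms] by metis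
  have "bounded (f ` K)"
    using K(1) Cc_inf_imp_smooth[OF assms]
    by (intro compact_imp_bounded compact_continuous_image smooth_imp_continuous_on)
  then obtain B where B: "\<And>x. x \<in> K \<Longrightarrow> norm (f x) \<le> B" unfolding bounded_iff by force
  show thesis
  proof (rule that)
    show "norm (f x) \<le> max B 0" for x
      using B[of x] K(2)[of x] by (cases "x \<in> K") auto
  qed simp
qed

lemma Cc_inf_grad: assumes "f \<in> Cc_inf \<Omega>" shows "grad f \<in> Cc_inf \<Omega>"
proof -
  obtain K where K: "compact K" "K \<subseteq> \<Omega>" "\<And>x. x \<notin> K \<Longrightarrow> f x = 0" using Cc_infE[OF assms] by metis
  have "grad f x = 0" if "x \<notin> K" for x
    using partial_deriv_eq_0[of "- K" x f] K that
    by (simp add: grad_def vec_eq_iff compact_imp_closed open_Compl)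
  then show ?thesis
    using K Cc_inf_imp_smooth[OF assms] by (intro Cc_infI[where K=K] smooth_grad)
qed

lemma Cc_inf_jacobian:
  fixes w :: "real^'n \<Rightarrow> real^'m"
  assumes "w \<in> Cc_inf \<Omega>" shows "(\<lambda>x. jacobian w (at x)) \<in> Cc_inf \<Omega>"
proof -
  obtain K where K: "compact K" "K \<subseteq> \<Omega>" "\<And>x. x \<notin> K \<Longrightarrow> w x = 0" using Cc_infE[OF assms] by metis
  have "jacobian w (at x) = 0" if "x \<notin> K" for x
    using partial_deriv_eq_0[of "- K" x w] K that
    by (simp add: jacobian_nth vec_eq_iff[of "_ $ _"] vec_eq_iff[of "jacobian _ _"] compact_imp_closed open_Compl)
  then show ?thesis
    using K Cc_inf_imp_smooth[OF assms] by (intro Cc_infI[where K=K] smooth_jacobian)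
qed

text \<open>Support is inherited by anything that vanishes where \<open>f\<close> does; this covers
  products, components, multiples and the potential, once smoothness is known.\<close>

lemma Cc_inf_of_zero_set:
  assumes "f \<in> Cc_inf \<Omega>" "smooth g" "\<And>x. f x = 0 \<Longrightarrow> g x = 0"
  shows "g \<in> Cc_inf \<Omega>"
proof -
  obtain K where "compact K" "K \<subseteq> \<Omega>" "\<And>x. x \<notin> K \<Longrightarrow> f x = 0" using Cc_infE[OF assms(1)] by metis
  with assms show ?thesis by (intro Cc_infI[where K = K]) auto
qed

lemma Cc_inf_inner_const: "f \<in> Cc_inf \<Omega> \<Longrightarrow> (\<lambda>x. v \<bullet> f x) \<in> Cc_inf \<Omega>"
  by (rule Cc_inf_of_zero_set, assumption) (auto intro!: smooth_inner dest: Cc_inf_imp_smooth)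

lemma Cc_inf_scaleR_left: "f \<in> Cc_inf \<Omega> \<Longrightarrow> (\<lambda>x. k *\<^sub>R f x) \<in> Cc_inf \<Omega>"
  by (rule Cc_inf_of_zero_set, assumption) (auto intro!: smooth_scaleR dest: Cc_inf_imp_smooth)

lemma Cc_inf_mult_left:
  fixes f g :: "real^'n \<Rightarrow> real"
  shows "f \<in> Cc_inf \<Omega> \<Longrightarrow> smooth g \<Longrightarrow> (\<lambda>x. f x * g x) \<in> Cc_inf \<Omega>"
  by (rule Cc_inf_of_zero_set, assumption) (auto intro!: smooth_mult dest: Cc_inf_imp_smooth)

lemma Cc_inf_diff: "f \<in> Cc_inf \<Omega> \<Longrightarrow> g \<in> Cc_inf \<Omega> \<Longrightarrow> (\<lambda>x. f x - g x) \<in> Cc_inf \<Omega>"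
  using Cc_inf_add[of f \<Omega> "\<lambda>x. (-1) *\<^sub>R g x"] Cc_inf_scaleR_left[of g \<Omega> "-1"] by simp

lemma Cc_inf_nth: "w \<in> Cc_inf \<Omega> \<Longrightarrow> (\<lambda>x. w x $ i) \<in> Cc_inf \<Omega>"
  by (rule Cc_inf_of_zero_set, assumption) (auto intro!: smooth_nth dest: Cc_inf_imp_smooth)

subsection \<open>Plane waves\<close>

lemma grad_mult:
  "smooth f \<Longrightarrow> smooth g \<Longrightarrow> grad (\<lambda>x. f x * g x) x = f x *\<^sub>R grad g x + g x *\<^sub>R grad f x"
  by (rule grad_eq)
    (auto intro!: derivative_eq_intros has_derivative_grad simp: inner_add_left algebra_simps)

lemma grad_add:
  "smooth f \<Longrightarrow> smooth g \<Longrightarrow> grad (\<lambda>x. f x + g x) x = grad f x + grad g x"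
  by (rule grad_eq)
    (auto intro!: derivative_eq_intros has_derivative_grad simp: inner_add_left)

lemma grad_cmult: "smooth f \<Longrightarrow> grad (\<lambda>x. k * f x) x = k *\<^sub>R grad f x"
  by (rule grad_eq) (auto intro!: derivative_eq_intros has_derivative_grad)

lemma grad_plane_wave:
  "grad (\<lambda>x. cos (u \<bullet> x + \<theta>)) x = cos (u \<bullet> x + (\<theta> + pi/2)) *\<^sub>R u"
  by (rule grad_eq)
    (auto intro!: derivative_eq_intros simp: cos_add sin_add algebra_simps)

lemma directional_grad_wave:
  assumes "smooth S"
  shows "v \<bullet> grad (\<lambda>x. S x * cos (u \<bullet> x + \<theta>)) x =
    (v \<bullet> u) * (S x * cos (u \<bullet> x + (\<theta> + pi/2))) + (v \<bullet> grad S x) * cos (u \<bullet> x + \<theta>)"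
  by (simp add: grad_mult assms smooth_plane_wave grad_plane_wave inner_add_right)

lemma grad_directional_grad_wave:
  assumes "smooth S"
  shows "grad (\<lambda>x. v \<bullet> grad (\<lambda>x. S x * cos (u \<bullet> x + \<theta>)) x) x =
    (v \<bullet> u) *\<^sub>R (cos (u \<bullet> x + (\<theta> + pi/2)) *\<^sub>R grad S x - (S x * cos (u \<bullet> x + \<theta>)) *\<^sub>R u)
      + cos (u \<bullet> x + \<theta>) *\<^sub>R grad (\<lambda>x. v \<bullet> grad S x) x
      + ((v \<bullet> grad S x) * cos (u \<bullet> x + (\<theta> + pi/2))) *\<^sub>R u"
proof -
  \<comment> \<open>Two quarter-period shifts reverse the sign; this produces the minus sign of the
    leading second-order term.\<close>
  have "cos (y + (\<theta> + pi/2 + pi/2)) = - cos (y + \<theta>)" for y :: real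
    using cos_periodic_pi[of "y + \<theta>"] by (simp add: algebra_simps)
  then have "grad (\<lambda>x. S x * cos (u \<bullet> x + (\<theta> + pi/2))) x =
      cos (u \<bullet> x + (\<theta> + pi/2)) *\<^sub>R grad S x - (S x * cos (u \<bullet> x + \<theta>)) *\<^sub>R u"
    by (simp add: grad_mult assms smooth_plane_wave grad_plane_wave add.assoc)
  moreover have "grad (\<lambda>x. (v \<bullet> grad S x) * cos (u \<bullet> x + \<theta>)) x =
      cos (u \<bullet> x + \<theta>) *\<^sub>R grad (\<lambda>x. v \<bullet> grad S x) x
      + ((v \<bullet> grad S x) * cos (u \<bullet> x + (\<theta> + pi/2))) *\<^sub>R u"
    by (simp add: grad_mult assms smooth_plane_wave smooth_directional grad_plane_wave)
  ultimately show ?thesis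
    unfolding directional_grad_wave[OF assms]
    by (subst grad_add)
      (auto intro!: smooth_mult smooth_directional smooth_plane_wave assms
        simp: grad_cmult smooth_mult smooth_plane_wave assms)
qed

text \<open>
  The terms of order \<open>N\<^sup>2\<close> are split off, so that after division by \<open>N\<^sup>2\<close> the error is \<open>O(1/N)\<close>,
  uniformly in the phase.
\<close>

lemma wave_bounds:
  fixes S :: "real^'n \<Rightarrow> real"
  assumes S: "S \<in> Cc_inf \<Omega>"
  obtains B where "B \<ge> 0" "\<And>N \<theta> x. N \<ge> 1 \<Longrightarrow>
      \<bar>v \<bullet> grad (\<lambda>x. S x * cos ((N *\<^sub>R b) \<bullet> x + \<theta>)) x\<bar> \<le> B * N"
    "\<And>N \<theta> x. N \<ge> 1 \<Longrightarrow> norm (grad (\<lambda>x. v \<bullet> grad (\<lambda>x. S x * cos ((N *\<^sub>R b) \<bullet> x + \<theta>)) x) x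
      + (N\<^sup>2 * (v \<bullet> b) * (S x * cos ((N *\<^sub>R b) \<bullet> x + \<theta>))) *\<^sub>R b) \<le> B * N"
proof -
  have s: "smooth S" using S by (rule Cc_inf_imp_smooth)
  obtain B0 where B0: "B0 \<ge> 0" "\<And>x. norm (S x) \<le> B0"
    using Cc_inf_bounded[OF S] by metis
  obtain B1 where B1: "B1 \<ge> 0" "\<And>x. norm (grad S x) \<le> B1"
    using Cc_inf_bounded[OF Cc_inf_grad[OF S]] by metis
  obtain B2 where B2: "B2 \<ge> 0" "\<And>x. norm (v \<bullet> grad S x) \<le> B2"
    using Cc_inf_bounded[OF Cc_inf_inner_const[OF Cc_inf_grad[OF S]]] by metis
  obtain B3 where B3: "B3 \<ge> 0" "\<And>x. norm (grad (\<lambda>x. v \<bullet> grad S x) x) \<le> B3"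
    using Cc_inf_bounded[OF Cc_inf_grad[OF Cc_inf_inner_const[OF Cc_inf_grad[OF S]]]] by metis
  \<comment> \<open>One constant for both estimates. Terms of order 1 are absorbed into multiples of
    N, which is why N is required to be at least 1.\<close>
  let ?B = "\<bar>v \<bullet> b\<bar> * B0 + B2 + \<bar>v \<bullet> b\<bar> * B1 + B3 + B2 * norm b"
  have c1: "\<bar>y * cos z\<bar> \<le> \<bar>y\<bar>" for y z :: real
    using mult_left_mono[OF abs_cos_le_one[of z], of "\<bar>y\<bar>"] by (simp add: abs_mult)
  show thesis
  proof (rule that)
    show "?B \<ge> 0" using B0 B1 B2 B3 by simp
  next
    fix N \<theta> :: real and x assume N: "N \<ge> 1"
    have "\<bar>v \<bullet> grad (\<lambda>x. S x * cos ((N *\<^sub>R b) \<bullet> x + \<theta>)) x\<bar>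
      \<le> \<bar>(v \<bullet> (N *\<^sub>R b)) * (S x * cos ((N *\<^sub>R b) \<bullet> x + (\<theta> + pi/2)))\<bar> + \<bar>(v \<bullet> grad S x) * cos ((N *\<^sub>R b) \<bullet> x + \<theta>)\<bar>"
      unfolding directional_grad_wave[OF s] by (rule abs_triangle_ineq)
    also have "\<dots> \<le> N * (\<bar>v \<bullet> b\<bar> * B0) + N * B2"
    proof (rule add_mono)
      have "\<bar>(v \<bullet> (N *\<^sub>R b)) * (S x * cos ((N *\<^sub>R b) \<bullet> x + (\<theta> + pi/2)))\<bar> \<le> \<bar>v \<bullet> (N *\<^sub>R b)\<bar> * B0"
        unfolding abs_mult[of "v \<bullet> _"] using order_trans[OF c1] B0(2)
        by (intro mult_left_mono) (auto simp only: real_norm_def abs_ge_zero)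
      then show "\<bar>(v \<bullet> (N *\<^sub>R b)) * (S x * cos ((N *\<^sub>R b) \<bullet> x + (\<theta> + pi/2)))\<bar> \<le> N * (\<bar>v \<bullet> b\<bar> * B0)"
        using N by (simp add: abs_mult)
      have "\<bar>(v \<bullet> grad S x) * cos ((N *\<^sub>R b) \<bullet> x + \<theta>)\<bar> \<le> B2"
        using order_trans[OF c1] B2(2) by simp
      also have "\<dots> \<le> N * B2" using mult_right_mono[OF N B2(1)] by simp
      finally show "\<bar>(v \<bullet> grad S x) * cos ((N *\<^sub>R b) \<bullet> x + \<theta>)\<bar> \<le> N * B2" .
    qed
    also have "\<dots> \<le> N * ?B"
      unfolding distrib_left[symmetric] using N B0 B1 B2 B3 by (intro mult_left_mono) auto
    finally show "\<bar>v \<bullet> grad (\<lambda>x. S x * cos ((N *\<^sub>R b) \<bullet> x + \<theta>)) x\<bar> \<le> ?B * N"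
      by (simp only: mult.commute)
    let ?u = "N *\<^sub>R b"
    have cle: "norm (cos z *\<^sub>R y) \<le> norm y" for z :: real and y :: "real^'n"
      using mult_right_mono[OF abs_cos_le_one[of z], of "norm y"] by simp
    have "grad (\<lambda>x. v \<bullet> grad (\<lambda>x. S x * cos (?u \<bullet> x + \<theta>)) x) x
      + (N\<^sup>2 * (v \<bullet> b) * (S x * cos (?u \<bullet> x + \<theta>))) *\<^sub>R b
      = (N * (v \<bullet> b)) *\<^sub>R (cos (?u \<bullet> x + (\<theta> + pi/2)) *\<^sub>R grad S x)
      + cos (?u \<bullet> x + \<theta>) *\<^sub>R grad (\<lambda>x. v \<bullet> grad S x) x
      + N *\<^sub>R (cos (?u \<bullet> x + (\<theta> + pi/2)) *\<^sub>R ((v \<bullet> grad S x) *\<^sub>R b))"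
      unfolding grad_directional_grad_wave[OF s] by (simp add: algebra_simps power2_eq_square)
    also have "norm \<dots> \<le> N * (\<bar>v \<bullet> b\<bar> * B1) + N * B3 + N * (B2 * norm b)"
    proof (intro order_trans[OF norm_triangle_ineq] add_mono)
      show "norm ((N * (v \<bullet> b)) *\<^sub>R (cos (?u \<bullet> x + (\<theta> + pi/2)) *\<^sub>R grad S x)) \<le> N * (\<bar>v \<bullet> b\<bar> * B1)"
        unfolding norm_scaleR[of "N * (v \<bullet> b)"] using N order_trans[OF cle B1(2)]
        by (simp only: abs_mult abs_of_pos mult.assoc) (intro mult_left_mono; simp)
      have "norm (cos (?u \<bullet> x + \<theta>) *\<^sub>R grad (\<lambda>x. v \<bullet> grad S x) x) \<le> B3"
        by (rule order_trans[OF cle B3(2)])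
      also have "\<dots> \<le> N * B3" using mult_right_mono[OF N B3(1)] by simp
      finally show "norm (cos (?u \<bullet> x + \<theta>) *\<^sub>R grad (\<lambda>x. v \<bullet> grad S x) x) \<le> N * B3" .
      have "norm ((v \<bullet> grad S x) *\<^sub>R b) \<le> B2 * norm b"
        using B2(2)[of x] by (simp add: mult_right_mono)
      then have "norm (cos (?u \<bullet> x + (\<theta> + pi/2)) *\<^sub>R ((v \<bullet> grad S x) *\<^sub>R b)) \<le> B2 * norm b"
        by (rule order_trans[OF cle])
      then show "norm (N *\<^sub>R (cos (?u \<bullet> x + (\<theta> + pi/2)) *\<^sub>R ((v \<bullet> grad S x) *\<^sub>R b))) \<le> N * (B2 * norm b)"
        unfolding norm_scaleR[of N] using N by (simp only: abs_of_pos) (intro mult_left_mono; simp)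
    qed
    also have "\<dots> \<le> N * ?B"
      unfolding distrib_left[symmetric] using N B0 B1 B2 B3 by (intro mult_left_mono) auto
    finally show "norm (grad (\<lambda>x. v \<bullet> grad (\<lambda>x. S x * cos ((N *\<^sub>R b) \<bullet> x + \<theta>)) x) x
      + (N\<^sup>2 * (v \<bullet> b) * (S x * cos ((N *\<^sub>R b) \<bullet> x + \<theta>))) *\<^sub>R b) \<le> ?B * N"
      by (simp only: mult.commute)
  qed
qed

lemma lin_fun_eq_inner: "lin_fun L \<xi> = L \<bullet> \<xi>"
  by (simp add: lin_fun_def inner_vec_def)

lemma lin_fun_diff: "lin_fun L (\<xi> - \<zeta>) = lin_fun L \<xi> - lin_fun L \<zeta>"
  by (simp add: lin_fun_eq_inner inner_diff_right)

lemma lin_fun_add: "lin_fun L (\<xi> + \<zeta>) = lin_fun L \<xi> + lin_fun L \<zeta>"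
  by (simp add: lin_fun_eq_inner inner_add_right)

lemma lin_fun_tensor: "lin_fun L (tensor x y) = (x v* L) \<bullet> y"
  unfolding dot_lmul_matrix
  by (simp add: lin_fun_def tensor_def inner_vec_def matrix_vector_mult_def sum_distrib_left algebra_simps)

subsection \<open>The potential of the constrained rank-one direction\<close>

locale rank_one_direction =
  fixes \<Omega> :: "(real^'n) set" and L \<eta> :: "real^'n^'m" and a :: "real^'m" and b :: "real^'n"
  assumes open_\<Omega>: "open \<Omega>" and bounded_\<Omega>: "bounded \<Omega>"
    and norm_\<eta>: "norm \<eta> < 1" and a_nz: "a \<noteq> 0" and Lb_nz: "L *v b \<noteq> 0"
    and lin_ab: "lin_fun L (tensor a b) = 0"
begin

abbreviation "p \<equiv> (L *v b) v* L"
abbreviation "q \<equiv> a v* L"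

text \<open>
  Since \<open>lin_fun L (tensor x y) = (x v* L) \<bullet> y\<close>, the two terms contribute mixed second derivatives of
  \<open>f\<close> along \<open>p\<close> and \<open>q\<close> that cancel. As \<open>q \<bullet> b = 0 < p \<bullet> b\<close>, a plane wave in direction \<open>b\<close>
  has a potential whose gradient is, to leading order, a multiple of \<open>tensor a b\<close>.
\<close>

definition potential :: "(real^'n \<Rightarrow> real) \<Rightarrow> real^'n \<Rightarrow> real^'m" where
  "potential f x = (p \<bullet> grad f x) *\<^sub>R a - (q \<bullet> grad f x) *\<^sub>R (L *v b)"

lemma q_b: "q \<bullet> b = 0"
  using lin_ab by (simp add: lin_fun_tensor)

lemma p_b: "p \<bullet> b = (norm (L *v b))\<^sup>2"
  by (simp add: dot_lmul_matrix dot_square_norm)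

lemma b_nz: "b \<noteq> 0"
  using Lb_nz by auto

lemma smooth_potential: "smooth f \<Longrightarrow> smooth (potential f)"
  unfolding potential_def[abs_def]
  by (intro smooth_diff smooth_scaleR smooth_directional smooth_const)

lemma Cc_inf_potential: assumes "f \<in> Cc_inf \<Omega>" shows "potential f \<in> Cc_inf \<Omega>"
  by (rule Cc_inf_of_zero_set[OF Cc_inf_grad[OF assms] smooth_potential[OF Cc_inf_imp_smooth[OF assms]]])
    (simp add: potential_def)

lemma jacobian_potential:
  assumes "smooth f"
  shows "jacobian (potential f) (at x) =
    tensor a (grad (\<lambda>x. p \<bullet> grad f x) x) - tensor (L *v b) (grad (\<lambda>x. q \<bullet> grad f x) x)"
proof -
  have "(potential f has_derivative (\<lambda>h. (grad (\<lambda>x. p \<bullet> grad f x) x \<bullet> h) *\<^sub>R a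
      - (grad (\<lambda>x. q \<bullet> grad f x) x \<bullet> h) *\<^sub>R (L *v b))) (at x)"
    unfolding potential_def[abs_def]
    by (intro has_derivative_diff has_derivative_scaleR_left has_derivative_grad[OF smooth_directional[OF assms]])
  from partial_deriv_eq[OF this] show ?thesis
    by (simp add: vec_eq_iff jacobian_nth tensor_def inner_axis algebra_simps)
qed

lemma lin_fun_potential: "smooth f \<Longrightarrow> lin_fun L (jacobian (potential f) (at x)) = 0"
  using smooth_mixed_derivatives_commute[of f q p x]
  by (simp add: jacobian_potential lin_fun_diff lin_fun_tensor)


lemma norm_ab_pos: "norm (tensor a b) > 0"
  using a_nz b_nz by (simp add: norm_tensor)

lemma lmeasurable_\<Omega>: "\<Omega> \<in> lmeasurable"
  using open_\<Omega> bounded_\<Omega> by (simp add: lmeasurable_open)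

lemma integrable_\<Omega>:
  fixes f :: "real^'n \<Rightarrow> 'b::{banach, second_countable_topology}"
  shows "continuous_on UNIV f \<Longrightarrow> integrable (lebesgue_on \<Omega>) f"
  by (rule integrable_continuous_on_bounded[OF lmeasurable_\<Omega> bounded_\<Omega>])

text \<open>The frequency comes before the phase: the error bounds are uniform in \<theta>, so the
  phase can still be selected afterwards by comparing energies. Since \<open>S\<close> multiplies
  the wave before the potential is taken, compact support and the linear constraint are both
  exact.\<close>

lemma plane_wave_perturbation:
  assumes S: "S \<in> Cc_inf \<Omega>" and e: "e > 0"
  obtains N where "\<And>\<theta>. \<exists>z\<in>Cc_inf \<Omega>. \<forall>x. norm (z x) \<le> e \<and> lin_fun L (jacobian z (at x)) = 0 \<and>
    norm (jacobian z (at x) + (S x * cos ((N *\<^sub>R b) \<bullet> x + \<theta>)) *\<^sub>R tensor a b) \<le> e"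
proof -
  let ?c = "L *v b"
  let ?W = "\<lambda>N \<theta> x. S x * cos ((N *\<^sub>R b) \<bullet> x + \<theta>)"
  obtain Bp where Bp: "Bp \<ge> 0" "\<And>N \<theta> x. N \<ge> 1 \<Longrightarrow> \<bar>p \<bullet> grad (?W N \<theta>) x\<bar> \<le> Bp * N"
    "\<And>N \<theta> x. N \<ge> 1 \<Longrightarrow> norm (grad (\<lambda>x. p \<bullet> grad (?W N \<theta>) x) x + (N\<^sup>2 * (p \<bullet> b) * ?W N \<theta> x) *\<^sub>R b) \<le> Bp * N"
    by (rule wave_bounds[OF S, of p b]) (rule that; assumption)
  obtain Bq where Bq: "Bq \<ge> 0" "\<And>N \<theta> x. N \<ge> 1 \<Longrightarrow> \<bar>q \<bullet> grad (?W N \<theta>) x\<bar> \<le> Bq * N"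
    "\<And>N \<theta> x. N \<ge> 1 \<Longrightarrow> norm (grad (\<lambda>x. q \<bullet> grad (?W N \<theta>) x) x + (N\<^sup>2 * (q \<bullet> b) * ?W N \<theta> x) *\<^sub>R b) \<le> Bq * N"
    by (rule wave_bounds[OF S, of q b]) (rule that; assumption)
  define B where "B = (Bp * norm a + Bq * norm ?c) / (norm ?c)\<^sup>2"
  define N where "N = max 1 (B / e)"
  have N: "N \<ge> 1" "B / N \<le> e" and N0: "N > 0"
  proof -
    show "N \<ge> 1" "N > 0" by (simp_all add: N_def)
    have "B / e \<le> N" by (simp add: N_def)
    with \<open>N > 0\<close> e show "B / N \<le> e" by (simp add: field_simps)
  qed
  \<comment> \<open>The normalisation makes k N^2 (p . b) = 1, so the leading part of the gradient
    is exactly the wave times \<open>- tensor a b\<close>. The remainder and the map itself are then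
    bounded by B / N.\<close>
  define k where "k = 1 / (N\<^sup>2 * (norm ?c)\<^sup>2)"
  have kN: "k * N * (Bp * norm a + Bq * norm ?c) = B / N"
    using N0 Lb_nz by (simp add: k_def B_def power2_eq_square)
  have k: "k > 0" using N0 Lb_nz by (simp add: k_def)
  show thesis
  proof (rule that, rule bexI, intro allI conjI)
    fix \<theta>
    let ?f = "?W N \<theta>"
    let ?z = "\<lambda>x. k *\<^sub>R potential ?f x"
    have f: "?f \<in> Cc_inf \<Omega>" by (intro Cc_inf_mult_left S smooth_plane_wave)
    have sf: "smooth ?f" by (rule Cc_inf_imp_smooth[OF f])
    show "?z \<in> Cc_inf \<Omega>" by (intro Cc_inf_scaleR_left Cc_inf_potential f)
    fix x
    have J: "jacobian ?z (at x) = k *\<^sub>R jacobian (potential ?f) (at x)"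
      by (rule jacobian_scaleR[OF smooth_potential[OF sf]])
    show "lin_fun L (jacobian ?z (at x)) = 0"
      using lin_fun_potential[OF sf, of x] unfolding J lin_fun_eq_inner inner_scaleR_right by simp
    have "norm (potential ?f x) \<le> \<bar>p \<bullet> grad ?f x\<bar> * norm a + \<bar>q \<bullet> grad ?f x\<bar> * norm ?c"
      unfolding potential_def by (rule order_trans[OF norm_triangle_ineq4]) simp
    also have "\<dots> \<le> Bp * N * norm a + Bq * N * norm ?c"
      using Bp Bq N(1) by (intro add_mono mult_right_mono) auto
    finally have "norm (?z x) \<le> k * (Bp * N * norm a + Bq * N * norm ?c)"
      using k by simp
    also have "\<dots> = B / N" unfolding kN[symmetric] by (simp add: algebra_simps)
    finally show "norm (?z x) \<le> e" using N by simp
    let ?gp = "grad (\<lambda>x. p \<bullet> grad ?f x) x" and ?gq = "grad (\<lambda>x. q \<bullet> grad ?f x) x"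
    define Tp where "Tp = ?gp + (N\<^sup>2 * (p \<bullet> b) * ?f x) *\<^sub>R b"
    define Tq where "Tq = ?gq + (N\<^sup>2 * (q \<bullet> b) * ?f x) *\<^sub>R b"
    have T: "norm Tp \<le> Bp * N" "norm Tq \<le> Bq * N"
      unfolding Tp_def Tq_def by (rule Bp(3)[OF N(1)], rule Bq(3)[OF N(1)])
    have "k * N\<^sup>2 * (p \<bullet> b) = 1" using N0 Lb_nz by (simp add: k_def p_b)
    then have "?f x *\<^sub>R tensor a b = (k * (N\<^sup>2 * (p \<bullet> b) * ?f x)) *\<^sub>R tensor a b"
      by (simp add: mult.assoc[symmetric])
    then have eq: "jacobian ?z (at x) + ?f x *\<^sub>R tensor a b = k *\<^sub>R (tensor a Tp - tensor ?c Tq)"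
      unfolding Tp_def Tq_def J jacobian_potential[OF sf] q_b
      by (simp add: bounded_bilinear.add_right[OF bounded_bilinear_tensor]
          bounded_bilinear.scaleR_right[OF bounded_bilinear_tensor] scaleR_add_right scaleR_diff_right)
    have "norm (k *\<^sub>R (tensor a Tp - tensor ?c Tq)) \<le> k * (norm a * norm Tp + norm ?c * norm Tq)"
      unfolding norm_scaleR using k norm_triangle_ineq4[of "tensor a Tp" "tensor ?c Tq"]
      by (simp add: norm_tensor)
    also have "\<dots> \<le> k * (norm a * (Bp * N) + norm ?c * (Bq * N))"
      using T k by (intro mult_left_mono add_mono) auto
    also have "\<dots> = B / N" unfolding kN[symmetric] by (simp add: algebra_simps)
    finally show "norm (jacobian ?z (at x) + ?f x *\<^sub>R tensor a b) \<le> e"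
      unfolding eq using N by simp
  qed
qed

text \<open>The constant is 32 = 2 * 4^2: the amplitude carries a factor 1/4, and the better of two
  phases keeps at least half of the energy. The subtracted \<tau> pays for the part of the gradient
  that is not the leading wave.\<close>

lemma perturbation_step:
  fixes w :: "real^'n \<Rightarrow> real^'m" and X :: "real^'n \<Rightarrow> real"
  assumes w: "w \<in> Cc_inf \<Omega>" and lt1: "\<And>x. norm (\<eta> + jacobian w (at x)) < 1"
    and X: "X \<in> Cc_inf \<Omega>" "\<And>x. 0 \<le> X x" "\<And>x. X x \<le> 1" and \<tau>: "\<tau> > 0"
  obtains z where "z \<in> Cc_inf \<Omega>" "\<And>x. norm (z x) \<le> \<tau>"
    "\<And>x. lin_fun L (jacobian z (at x)) = 0"
    "\<And>x. norm (\<eta> + jacobian w (at x) + jacobian z (at x)) < 1"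
    "\<And>x. \<exists>\<sigma>. norm (jacobian z (at x) - \<sigma> *\<^sub>R tensor a b) \<le> \<tau>"
    "(LINT x|lebesgue_on \<Omega>. (X x * (1 - (norm (\<eta> + jacobian w (at x)))\<^sup>2))\<^sup>2) / 32 - \<tau>
      \<le> (LINT x|lebesgue_on \<Omega>. (norm (jacobian z (at x)))\<^sup>2)"
proof -
  define U where "U x = \<eta> + jacobian w (at x)" for x
  let ?A = "tensor a b"
  have sU: "smooth U"
    unfolding U_def[abs_def] by (intro smooth_add smooth_const smooth_jacobian Cc_inf_imp_smooth[OF w])
  \<comment> \<open>The pointwise strict inequality becomes uniform: the gradient of
    \<open>w\<close> is continuous and vanishes off a compact set, where only |\<eta>| < 1 remains.
    Inserting 0 keeps the compact set nonempty for the maximum.\<close>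
  obtain M where M: "M < 1" "\<And>x. norm (U x) \<le> M"
  proof -
    obtain K where K: "compact K" "\<And>x. x \<notin> K \<Longrightarrow> jacobian w (at x) = 0"
      using Cc_infE[OF Cc_inf_jacobian[OF w]] by metis
    let ?K = "insert 0 K"
    have "compact ?K" "?K \<noteq> {}" using K by auto
    then obtain y where y: "y \<in> ?K" "\<And>x. x \<in> ?K \<Longrightarrow> norm (U x) \<le> norm (U y)"
      using continuous_attains_sup[of ?K "\<lambda>x. norm (U x)"] smooth_imp_continuous_on[OF sU]
      by (metis continuous_on_norm)
    show thesis
    proof (rule that)
      show "max (norm \<eta>) (norm (U y)) < 1" using norm_\<eta> lt1 by (simp add: U_def)
      show "norm (U x) \<le> max (norm \<eta>) (norm (U y))" for x
        using y(2)[of x] K(2)[of x] by (cases "x \<in> K") (auto simp: U_def)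
    qed
  qed
  \<comment> \<open>The squared norm keeps the amplitude smooth even where U = 0. Because 1 - |U|^2
    is at most 2 (1 - |U|), the divisor 4 lets the wave use at most half of the distance from U to
    the unit sphere.\<close>
  define S where "S x = X x * ((1 - U x \<bullet> U x) / (4 * norm ?A))" for x
  have S: "S \<in> Cc_inf \<Omega>"
    unfolding S_def[abs_def] divide_inverse
    by (intro Cc_inf_mult_left X smooth_mult smooth_diff smooth_const smooth_inner sU)
  define \<mu> where "\<mu> = measure lebesgue \<Omega>"
  \<comment> \<open>The bound (1 - M) / 4 keeps the sum strictly inside the ball: (1 + M) / 2 + (1 -
    M) / 4 < 1. Division by 1 + \<mu> also keeps the integrated error \<open>e * \<mu>\<close> below
    \<tau>.\<close>
  define e where "e = min \<tau> ((1 - M) / 4) / (1 + \<mu>)"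
  have \<mu>: "\<mu> \<ge> 0" by (simp add: \<mu>_def)
  have m: "min \<tau> ((1 - M) / 4) > 0" using \<tau> M by simp
  have e: "e > 0" "e \<le> \<tau>" "e \<le> (1 - M) / 4" "e * \<mu> \<le> \<tau>"
  proof -
    show "e > 0" using m \<mu> by (simp add: e_def)
    have "e \<le> min \<tau> ((1 - M) / 4)"
      using m \<mu> mult_left_mono[of 1 "1 + \<mu>" "min \<tau> ((1 - M) / 4)"]
      unfolding e_def by (subst pos_divide_le_eq) auto
    then show "e \<le> \<tau>" "e \<le> (1 - M) / 4" by auto
    have "e * \<mu> \<le> e * (1 + \<mu>)" using \<open>e > 0\<close> by simp
    also have "\<dots> = min \<tau> ((1 - M) / 4)" using \<mu> by (simp add: e_def)
    finally show "e * \<mu> \<le> \<tau>" by simp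
  qed
  obtain N where N: "\<And>\<theta>. \<exists>z\<in>Cc_inf \<Omega>. \<forall>x. norm (z x) \<le> e \<and> lin_fun L (jacobian z (at x)) = 0 \<and>
    norm (jacobian z (at x) + (S x * cos ((N *\<^sub>R b) \<bullet> x + \<theta>)) *\<^sub>R ?A) \<le> e"
    using plane_wave_perturbation[OF S e(1)] by metis
  let ?C = "\<lambda>\<theta> x. cos ((N *\<^sub>R b) \<bullet> x + \<theta>)"
  let ?I = "\<lambda>\<theta>. LINT x|lebesgue_on \<Omega>. (S x * ?C \<theta> x * norm ?A)\<^sup>2"
  have SA: "S x * norm ?A = X x * (1 - (norm (U x))\<^sup>2) / 4" for x
    using norm_ab_pos by (simp add: S_def dot_square_norm)
  have SA_le: "0 \<le> S x * norm ?A" "S x * norm ?A \<le> (1 - norm (U x)) / 2" for x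
  proof -
    have u: "norm (U x) < 1" using lt1 by (simp add: U_def)
    have f: "1 - (norm (U x))\<^sup>2 = (1 - norm (U x)) * (1 + norm (U x))"
      by (simp add: power2_eq_square algebra_simps)
    have g: "0 \<le> 1 - (norm (U x))\<^sup>2" unfolding f using u by simp
    then show "0 \<le> S x * norm ?A" unfolding SA using X by simp
    have "X x * (1 - (norm (U x))\<^sup>2) \<le> 1 * (1 - (norm (U x))\<^sup>2)"
      using g X by (intro mult_right_mono) auto
    also have "\<dots> \<le> (1 - norm (U x)) * 2" unfolding f mult_1 using u by (intro mult_left_mono) auto
    finally show "S x * norm ?A \<le> (1 - norm (U x)) / 2" unfolding SA by simp
  qed
  have cont: "continuous_on UNIV S" "continuous_on UNIV (?C \<theta>)" for \<theta>
    by (rule smooth_imp_continuous_on[OF Cc_inf_imp_smooth[OF S]],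
        rule smooth_imp_continuous_on[OF smooth_plane_wave])
  \<comment> \<open>As \<open>cos\<^sup>2 + sin\<^sup>2 = 1\<close>, one of two phases carries at least half of the energy.\<close>
  have "?I 0 + ?I (- (pi/2)) = (LINT x|lebesgue_on \<Omega>. (S x * ?C 0 x * norm ?A)\<^sup>2 + (S x * ?C (- (pi/2)) x * norm ?A)\<^sup>2)"
    by (rule Bochner_Integration.integral_add[symmetric]) (auto intro!: integrable_\<Omega> continuous_intros cont)
  also have "\<dots> = (LINT x|lebesgue_on \<Omega>. (X x * (1 - (norm (U x))\<^sup>2))\<^sup>2 / 16)"
  proof (rule Bochner_Integration.integral_cong[OF refl])
    fix x
    have c: "?C (- (pi/2)) x = sin ((N *\<^sub>R b) \<bullet> x)" by (simp add: cos_diff)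
    have "(S x * ?C 0 x * norm ?A)\<^sup>2 + (S x * ?C (- (pi/2)) x * norm ?A)\<^sup>2
      = (S x * norm ?A)\<^sup>2 * ((cos ((N *\<^sub>R b) \<bullet> x))\<^sup>2 + (sin ((N *\<^sub>R b) \<bullet> x))\<^sup>2)"
      unfolding c by (simp only: power_mult_distrib distrib_left mult_ac add_0_right)
    then show "(S x * ?C 0 x * norm ?A)\<^sup>2 + (S x * ?C (- (pi/2)) x * norm ?A)\<^sup>2
      = (X x * (1 - (norm (U x))\<^sup>2))\<^sup>2 / 16"
      by (simp add: SA power_divide)
  qed
  also have "\<dots> = (LINT x|lebesgue_on \<Omega>. (X x * (1 - (norm (U x))\<^sup>2))\<^sup>2) / 16" by simp
  finally have sum: "?I 0 + ?I (- (pi/2)) = (LINT x|lebesgue_on \<Omega>. (X x * (1 - (norm (U x))\<^sup>2))\<^sup>2) / 16" .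
  have halves: "y / 32 \<le> I \<or> y / 32 \<le> I'" if "I + I' = y / 16" for y I I' :: real
    using that by linarith
  obtain \<theta> where \<theta>: "(LINT x|lebesgue_on \<Omega>. (X x * (1 - (norm (U x))\<^sup>2))\<^sup>2) / 32 \<le> ?I \<theta>"
    using halves[OF sum] by (rule disjE)
  obtain z where z1: "z \<in> Cc_inf \<Omega>" and z2: "\<forall>x. norm (z x) \<le> e \<and> lin_fun L (jacobian z (at x)) = 0 \<and>
    norm (jacobian z (at x) + (S x * ?C \<theta> x) *\<^sub>R ?A) \<le> e"
    using N[of \<theta>] by (rule bexE)
  have z: "z \<in> Cc_inf \<Omega>" "norm (z x) \<le> e" "lin_fun L (jacobian z (at x)) = 0"
    "norm (jacobian z (at x) + (S x * ?C \<theta> x) *\<^sub>R ?A) \<le> e" for x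
    using z1 z2[rule_format, of x] by simp_all
  have amp: "\<bar>S x * ?C \<theta> x\<bar> * norm ?A \<le> (1 - norm (U x)) / 2" for x
  proof -
    have "\<bar>S x * ?C \<theta> x\<bar> * norm ?A = (S x * norm ?A) * \<bar>?C \<theta> x\<bar>"
      using SA_le(1)[of x] norm_ab_pos by (simp add: abs_mult zero_le_mult_iff)
    also have "\<dots> \<le> S x * norm ?A"
      using mult_left_mono[OF abs_cos_le_one SA_le(1)] by simp
    finally show ?thesis using SA_le(2)[of x] by simp
  qed
  show thesis
  proof (rule that[OF z(1)])
    fix x
    let ?J = "jacobian z (at x)"
    show "norm (z x) \<le> \<tau>" using z(2)[of x] e by simp
    show "lin_fun L ?J = 0" by (rule z(3))
    have "\<eta> + jacobian w (at x) + ?J = U x - (S x * ?C \<theta> x) *\<^sub>R ?A + (?J + (S x * ?C \<theta> x) *\<^sub>R ?A)"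
      by (simp add: U_def)
    also have "norm \<dots> \<le> norm (U x) + \<bar>S x * ?C \<theta> x\<bar> * norm ?A + e"
      using norm_triangle_ineq[of "U x - (S x * ?C \<theta> x) *\<^sub>R ?A" "?J + (S x * ?C \<theta> x) *\<^sub>R ?A"]
        norm_triangle_ineq4[of "U x" "(S x * ?C \<theta> x) *\<^sub>R ?A"] z(4)[of x]
      unfolding norm_scaleR by linarith
    also have "\<dots> \<le> norm (U x) + (1 - norm (U x)) / 2 + (1 - M) / 4"
      using amp e by (intro add_mono) auto
    also have "\<dots> < 1" using M(1) M(2)[of x] by argo
    finally show "norm (\<eta> + jacobian w (at x) + ?J) < 1" .
    show "\<exists>\<sigma>. norm (?J - \<sigma> *\<^sub>R ?A) \<le> \<tau>"
      by (rule exI[of _ "- (S x * ?C \<theta> x)"]) (use z(4)[of x] e(2) in simp)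
  next
    have cJ: "continuous_on UNIV (\<lambda>x. jacobian z (at x))"
      by (intro smooth_imp_continuous_on smooth_jacobian Cc_inf_imp_smooth[OF z(1)])
    \<comment> \<open>The amplitude s is at most 1/2, so the loss 2 s e in (s - e)^2 is at most e.
      The case s \<le> e is separate because s - e must be nonnegative before the lower bound for
      |Dz| can be squared.\<close>
    have sq: "(S x * ?C \<theta> x * norm ?A)\<^sup>2 \<le> (norm (jacobian z (at x)))\<^sup>2 + e" for x
    proof -
      let ?s = "\<bar>S x * ?C \<theta> x\<bar> * norm ?A"
      have s: "0 \<le> ?s" by (intro mult_nonneg_nonneg) simp_all
      have s': "?s \<le> 1 / 2" using amp[of x] norm_ge_zero[of "U x"] by argo
      have "norm ((S x * ?C \<theta> x) *\<^sub>R ?A) - norm (jacobian z (at x) + (S x * ?C \<theta> x) *\<^sub>R ?A) \<le> norm (jacobian z (at x))"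
        using norm_triangle_ineq4[of "jacobian z (at x) + (S x * ?C \<theta> x) *\<^sub>R ?A" "jacobian z (at x)"] by simp
      then have d: "?s - e \<le> norm (jacobian z (at x))" using z(4)[of x] by simp
      have "?s\<^sup>2 \<le> (norm (jacobian z (at x)))\<^sup>2 + e"
      proof (cases "?s \<le> e")
        case True
        have "?s\<^sup>2 \<le> 1 * e"
          unfolding power2_eq_square using s s' True by (intro mult_mono) auto
        then show ?thesis by (simp add: add_increasing)
      next
        case False
        have "?s\<^sup>2 - 2 * ?s * e \<le> (?s - e)\<^sup>2" by (simp add: power2_eq_square algebra_simps)
        also have "\<dots> \<le> (norm (jacobian z (at x)))\<^sup>2" using False d by (intro power_mono) auto
        finally have "?s\<^sup>2 - 2 * ?s * e \<le> (norm (jacobian z (at x)))\<^sup>2" .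
        moreover have "2 * ?s * e \<le> 1 * e" using s' e(1) by (intro mult_right_mono) auto
        ultimately show ?thesis by linarith
      qed
      then show ?thesis by (simp add: power_mult_distrib)
    qed
    have "?I \<theta> \<le> (LINT x|lebesgue_on \<Omega>. (norm (jacobian z (at x)))\<^sup>2 + e)"
      by (rule integral_mono[OF _ _ sq]) (auto intro!: integrable_\<Omega> continuous_intros cont cJ)
    also have "\<dots> = (LINT x|lebesgue_on \<Omega>. (norm (jacobian z (at x)))\<^sup>2) + (LINT x|lebesgue_on \<Omega>. e)"
      by (rule Bochner_Integration.integral_add) (auto intro!: integrable_\<Omega> continuous_intros cJ)
    also have "(LINT x|lebesgue_on \<Omega>. e) = e * \<mu>"
      using lmeasurable_\<Omega> by (simp add: \<mu>_def measure_restrict_space)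
    finally show "(LINT x|lebesgue_on \<Omega>. (X x * (1 - (norm (\<eta> + jacobian w (at x)))\<^sup>2))\<^sup>2) / 32 - \<tau>
      \<le> (LINT x|lebesgue_on \<Omega>. (norm (jacobian z (at x)))\<^sup>2)"
      using \<theta> e(4) unfolding U_def by simp
  qed
qed

end

subsection \<open>Convergence of the iteration\<close>

context rank_one_direction
begin

text \<open>All derivatives are moved from z to the fixed map \<open>w\<close>. The constant is a
  sum of L^1 norms of derivatives of the components of \<open>\<eta> + Dw\<close>, so it is
  independent of z and of the size of its gradient.\<close>

lemma integral_inner_jacobian_le:
  fixes w :: "real^'n \<Rightarrow> real^'m"
  assumes w: "w \<in> Cc_inf \<Omega>"
  shows "\<exists>C\<ge>0. \<forall>z t. z \<in> Cc_inf \<Omega> \<longrightarrow> (\<forall>x. norm (z x) \<le> t) \<longrightarrow>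
    \<bar>LINT x|lebesgue_on \<Omega>. (\<eta> + jacobian w (at x)) \<bullet> jacobian z (at x)\<bar> \<le> C * t"
proof -
  define h where "h i j x = (\<eta> + jacobian w (at x)) $ i $ j" for i j x
  have h: "smooth (h i j)" for i j
    unfolding h_def
    by (intro smooth_nth smooth_add smooth_const smooth_jacobian Cc_inf_imp_smooth[OF w])
  define c where "c i j = (LINT x|lebesgue_on \<Omega>. \<bar>partial_deriv j (h i j) x\<bar>)" for i j
  have c: "c i j \<ge> 0" for i j by (simp add: c_def)
  show ?thesis
  proof (intro exI conjI allI impI)
    show "(\<Sum>i\<in>UNIV. \<Sum>j\<in>UNIV. c i j) \<ge> 0" using c by (intro sum_nonneg)
    fix z :: "real^'n \<Rightarrow> real^'m" and t assume z: "z \<in> Cc_inf \<Omega>" and t': "\<forall>x. norm (z x) \<le> t"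
    have t: "norm (z x) \<le> t" for x using t' ..
    have sz: "smooth z" by (rule Cc_inf_imp_smooth[OF z])
    have cc: "continuous_on UNIV (h i j)" "continuous_on UNIV (partial_deriv k (h i j))"
      "continuous_on UNIV (\<lambda>x. z x $ i)" "continuous_on UNIV (partial_deriv j (\<lambda>x. z x $ i))" for i j k
      by (intro smooth_imp_continuous_on h smooth_partial_deriv smooth_nth sz)+
    have one: "\<bar>LINT x|lebesgue_on \<Omega>. h i j x * partial_deriv j (\<lambda>x. z x $ i) x\<bar> \<le> c i j * t" for i j
    proof -
      have "(LINT x|lebesgue_on \<Omega>. h i j x * partial_deriv j (\<lambda>x. z x $ i) x)
        = - (LINT x|lebesgue_on \<Omega>. partial_deriv j (h i j) x * (z x $ i))"
        by (rule integration_by_parts[OF open_\<Omega> bounded_\<Omega>])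
          (use h in \<open>auto simp: smooth_def intro!: Cc_inf_imp_Cc Cc_inf_nth z simp del: class_C.simps\<close>)
      then have "\<bar>LINT x|lebesgue_on \<Omega>. h i j x * partial_deriv j (\<lambda>x. z x $ i) x\<bar>
        \<le> (LINT x|lebesgue_on \<Omega>. \<bar>partial_deriv j (h i j) x * (z x $ i)\<bar>)"
        by (simp del: abs_mult)
      also have "\<dots> \<le> (LINT x|lebesgue_on \<Omega>. \<bar>partial_deriv j (h i j) x\<bar> * t)"
      proof (rule integral_mono)
        show "\<bar>partial_deriv j (h i j) x * z x $ i\<bar> \<le> \<bar>partial_deriv j (h i j) x\<bar> * t" for x
          unfolding abs_mult using component_le_norm_cart[of "z x" i] t[of x] by (intro mult_left_mono) auto
      qed (auto intro!: integrable_\<Omega> continuous_intros cc)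
      finally show ?thesis by (simp add: c_def)
    qed
    have "(LINT x|lebesgue_on \<Omega>. (\<eta> + jacobian w (at x)) \<bullet> jacobian z (at x))
      = (LINT x|lebesgue_on \<Omega>. (\<Sum>i\<in>UNIV. \<Sum>j\<in>UNIV. h i j x * partial_deriv j (\<lambda>x. z x $ i) x))"
      by (simp add: inner_vec_def h_def jacobian_nth partial_deriv_nth smooth_imp_differentiable[OF sz])
    also have "\<dots> = (\<Sum>i\<in>UNIV. \<Sum>j\<in>UNIV. (LINT x|lebesgue_on \<Omega>. h i j x * partial_deriv j (\<lambda>x. z x $ i) x))"
      by (subst Bochner_Integration.integral_sum, intro integrable_\<Omega> continuous_intros cc,
          rule sum.cong[OF refl], rule Bochner_Integration.integral_sum, intro integrable_\<Omega> continuous_intros cc)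
    finally have "\<bar>LINT x|lebesgue_on \<Omega>. (\<eta> + jacobian w (at x)) \<bullet> jacobian z (at x)\<bar>
      \<le> (\<Sum>i\<in>UNIV. \<Sum>j\<in>UNIV. \<bar>LINT x|lebesgue_on \<Omega>. h i j x * partial_deriv j (\<lambda>x. z x $ i) x\<bar>)"
      by (simp only:) (rule order_trans[OF sum_abs sum_mono[OF sum_abs]])
    also have "\<dots> \<le> (\<Sum>i\<in>UNIV. \<Sum>j\<in>UNIV. c i j * t)"
      by (intro sum_mono one)
    finally show "\<bar>LINT x|lebesgue_on \<Omega>. (\<eta> + jacobian w (at x)) \<bullet> jacobian z (at x)\<bar>
      \<le> (\<Sum>i\<in>UNIV. \<Sum>j\<in>UNIV. c i j) * t"
      by (simp add: sum_distrib_right)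
  qed
qed

definition admissible :: "(real^'n \<Rightarrow> real^'m) \<Rightarrow> bool" where
  "admissible w \<longleftrightarrow> w \<in> Cc_inf \<Omega> \<and> (\<forall>x. norm (\<eta> + jacobian w (at x)) < 1 \<and> lin_fun L (jacobian w (at x)) = 0)"

text \<open>
  A perturbation of size \<open>s t\<close> in the supremum norm, whatever the size of its gradient, is orthogonal to
  \<open>\<eta> + jacobian w\<close> up to \<open>s \<delta>\<close>.
\<close>

definition almost_orthogonal :: "(real^'n \<Rightarrow> real^'m) \<Rightarrow> real \<Rightarrow> real \<Rightarrow> bool" where
  "almost_orthogonal w t \<delta> \<longleftrightarrow> (\<forall>z s. z \<in> Cc_inf \<Omega> \<longrightarrow> s \<ge> 0 \<longrightarrow> (\<forall>x. norm (z x) \<le> s * t) \<longrightarrow>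
    \<bar>LINT x|lebesgue_on \<Omega>. (\<eta> + jacobian w (at x)) \<bullet> jacobian z (at x)\<bar> \<le> s * \<delta>)"

text \<open>The constant from integration by parts depends on the second derivatives of
  \<open>w\<close>, which grow with the frequencies already used. Hence the tolerance
  \<open>t\<close> is chosen for each \<open>w\<close> separately; \<open>r\<close> allows it to be
  made smaller than a previous tolerance.\<close>

lemma almost_orthogonal_exists:
  assumes w: "w \<in> Cc_inf \<Omega>" and "\<delta> > 0" "r > 0"
  obtains t where "t > 0" "t \<le> r" "almost_orthogonal w t \<delta>"
proof -
  obtain C where C: "C \<ge> 0" "\<forall>z t. z \<in> Cc_inf \<Omega> \<longrightarrow> (\<forall>x. norm (z x) \<le> t) \<longrightarrow>
    \<bar>LINT x|lebesgue_on \<Omega>. (\<eta> + jacobian w (at x)) \<bullet> jacobian z (at x)\<bar> \<le> C * t"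
    using integral_inner_jacobian_le[OF w] by blast
  define t where "t = min r (\<delta> / (C + 1))"
  have t: "t > 0" "t \<le> r" "C * t \<le> \<delta>"
  proof -
    show t0: "t > 0" "t \<le> r" using assms C(1) by (auto simp: t_def)
    have "t \<le> \<delta> / (C + 1)" by (simp add: t_def)
    then have "(C + 1) * t \<le> \<delta>" using C(1) by (simp add: pos_le_divide_eq mult.commute)
    then show "C * t \<le> \<delta>" using t0 by (simp add: algebra_simps)
  qed
  have "almost_orthogonal w t \<delta>"
    unfolding almost_orthogonal_def
  proof (intro allI impI)
    fix z :: "real^'n \<Rightarrow> real^'m" and s :: real assume z: "z \<in> Cc_inf \<Omega>" and s: "s \<ge> 0" "\<forall>x. norm (z x) \<le> s * t"
    have "\<bar>LINT x|lebesgue_on \<Omega>. (\<eta> + jacobian w (at x)) \<bullet> jacobian z (at x)\<bar> \<le> C * (s * t)"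
      using C(2) z s(2) by blast
    also have "\<dots> \<le> s * \<delta>" using mult_left_mono[OF t(3) s(1)] by (simp add: algebra_simps)
    finally show "\<bar>LINT x|lebesgue_on \<Omega>. (\<eta> + jacobian w (at x)) \<bullet> jacobian z (at x)\<bar> \<le> s * \<delta>" .
  qed
  with t that show thesis by blast
qed

text \<open>\<open>t k\<close> is fixed together with \<open>w k\<close>, before the next wave, and
  restrains all later waves: by halving, the tolerances from index k on sum to at most
  \<open>2 * t k\<close>. Thus \<open>w k\<close> is almost orthogonal to the gradient of the whole
  subsequent change, not merely of one step.\<close>

lemma approximating_sequence:
  assumes w0: "admissible w0" and \<tau>: "\<tau> > 0"
    and X: "\<And>k. X k \<in> Cc_inf \<Omega>" "\<And>k x. 0 \<le> X k x" "\<And>k x. (X k x :: real) \<le> 1"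
  obtains w t where "w 0 = w0" "2 * t 0 \<le> \<tau>" "\<And>k. admissible (w k)"
    "\<And>k. t k > 0" "\<And>k. t (Suc k) \<le> t k / 2" "\<And>k. almost_orthogonal (w k) (t k) ((1/2) ^ k)"
    "\<And>k x. norm (w (Suc k) x - w k x) \<le> t k"
    "\<And>k x. \<exists>\<sigma>. norm (jacobian (w (Suc k)) (at x) - jacobian (w k) (at x) - \<sigma> *\<^sub>R tensor a b) \<le> t k"
    "\<And>k. (LINT x|lebesgue_on \<Omega>. (X k x * (1 - (norm (\<eta> + jacobian (w k) (at x)))\<^sup>2))\<^sup>2) / 32 - t k
      \<le> (LINT x|lebesgue_on \<Omega>. (norm (jacobian (w (Suc k)) (at x) - jacobian (w k) (at x)))\<^sup>2)"
proof -
  \<comment> \<open>The state of the dependent choice is the pair of map and tolerance. The clause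
    for k = 0 pins the starting map and the total budget \<tau>.\<close>
  define P where "P k wt \<longleftrightarrow> (k = 0 \<longrightarrow> fst wt = w0 \<and> 2 * snd wt \<le> \<tau>) \<and> admissible (fst wt) \<and> snd wt > 0 \<and>
    almost_orthogonal (fst wt) (snd wt) ((1/2) ^ k)" for k :: nat and wt :: "(real^'n \<Rightarrow> real^'m) \<times> real"
  define Q where "Q k wt wt' \<longleftrightarrow> snd wt' \<le> snd wt / 2 \<and> (\<forall>x. norm (fst wt' x - fst wt x) \<le> snd wt) \<and>
    (\<forall>x. \<exists>\<sigma>. norm (jacobian (fst wt') (at x) - jacobian (fst wt) (at x) - \<sigma> *\<^sub>R tensor a b) \<le> snd wt) \<and>
    (LINT x|lebesgue_on \<Omega>. (X k x * (1 - (norm (\<eta> + jacobian (fst wt) (at x)))\<^sup>2))\<^sup>2) / 32 - snd wt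
      \<le> (LINT x|lebesgue_on \<Omega>. (norm (jacobian (fst wt') (at x) - jacobian (fst wt) (at x)))\<^sup>2)"
    for k and wt wt' :: "(real^'n \<Rightarrow> real^'m) \<times> real"
  have "\<exists>f. \<forall>k. P k (f k) \<and> Q k (f k) (f (Suc k))"
  proof (rule dependent_nat_choice)
    obtain t where "t > 0" "t \<le> \<tau> / 2" "almost_orthogonal w0 t ((1/2) ^ 0)"
      using almost_orthogonal_exists[of w0 "(1/2) ^ 0" "\<tau> / 2"] w0 \<tau> by (auto simp: admissible_def)
    then show "\<exists>wt. P 0 wt"
      by (intro exI[of _ "(w0, t)"]) (use w0 in \<open>auto simp: P_def\<close>)
  next
    fix wt :: "(real^'n \<Rightarrow> real^'m) \<times> real" and k assume P: "P k wt"
    obtain w t where wt: "wt = (w, t)" by fastforce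
    have adm: "admissible w" and t: "t > 0" using P by (auto simp: P_def wt)
    have w: "w \<in> Cc_inf \<Omega>" "norm (\<eta> + jacobian w (at x)) < 1" "lin_fun L (jacobian w (at x)) = 0" for x
      using adm by (auto simp: admissible_def)
    obtain z where z: "z \<in> Cc_inf \<Omega>" "\<And>x. norm (z x) \<le> t" "\<And>x. lin_fun L (jacobian z (at x)) = 0"
      "\<And>x. norm (\<eta> + jacobian w (at x) + jacobian z (at x)) < 1"
      "\<And>x. \<exists>\<sigma>. norm (jacobian z (at x) - \<sigma> *\<^sub>R tensor a b) \<le> t"
      "(LINT x|lebesgue_on \<Omega>. (X k x * (1 - (norm (\<eta> + jacobian w (at x)))\<^sup>2))\<^sup>2) / 32 - t
        \<le> (LINT x|lebesgue_on \<Omega>. (norm (jacobian z (at x)))\<^sup>2)"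
      by (rule perturbation_step[OF w(1,2) X t]) (rule that; assumption)
    define w' where "w' x = w x + z x" for x
    have J: "jacobian w' (at x) = jacobian w (at x) + jacobian z (at x)" for x
      unfolding w'_def by (intro jacobian_add Cc_inf_imp_smooth[OF w(1)] Cc_inf_imp_smooth[OF z(1)])
    have w': "admissible w'"
      unfolding admissible_def
    proof (intro conjI allI)
      show "w' \<in> Cc_inf \<Omega>" unfolding w'_def[abs_def] by (rule Cc_inf_add[OF w(1) z(1)])
      show "norm (\<eta> + jacobian w' (at x)) < 1" for x
        using z(4)[of x] by (simp add: J add.assoc)
      show "lin_fun L (jacobian w' (at x)) = 0" for x
        by (simp add: J lin_fun_add w(3) z(3))
    qed
    then obtain t' where t': "t' > 0" "t' \<le> t / 2" "almost_orthogonal w' t' ((1/2) ^ Suc k)"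
      using almost_orthogonal_exists[of w' "(1/2) ^ Suc k" "t / 2"] t by (auto simp: admissible_def)
    have "P (Suc k) (w', t')" unfolding P_def using w' t' by simp
    moreover have "Q k wt (w', t')"
      unfolding Q_def wt fst_conv snd_conv J add_diff_cancel_left' using z t'
      by (auto simp: w'_def)
    ultimately show "\<exists>wt'. P (Suc k) wt' \<and> Q k wt wt'" by blast
  qed
  then obtain f where f: "\<And>k. P k (f k)" "\<And>k. Q k (f k) (f (Suc k))" by blast
  show thesis
    by (rule that[of "\<lambda>k. fst (f k)" "\<lambda>k. snd (f k)"])
      (use f in \<open>auto simp: P_def Q_def\<close>)
qed

end

section \<open>Measurability, integral bounds and almost monotone sequences\<close>

lemma borel_measurable_lebesgue_on:
  fixes f :: "'a::euclidean_space \<Rightarrow> 'b::topological_space"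
  shows "f \<in> borel_measurable borel \<Longrightarrow> f \<in> borel_measurable (lebesgue_on S)"
  by (intro measurable_restrict_space1 measurable_completion) simp

lemma norm_weighted_defect_le_one:
  fixes x u :: real
  assumes "0 \<le> x" "x \<le> 1" "0 \<le> u" "u \<le> 1"
  shows "norm ((x * (1 - u\<^sup>2))\<^sup>2) \<le> 1"
proof -
  have "0 \<le> 1 - u\<^sup>2" "1 - u\<^sup>2 \<le> 1" using assms by (auto simp: power_le_one)
  then have "0 \<le> x * (1 - u\<^sup>2)" "x * (1 - u\<^sup>2) \<le> 1"
    using assms by (auto intro: mult_le_one)
  then show ?thesis by (simp add: power_le_one)
qed

text \<open>Integrate the inequality y \<le> s + y^2 / s. With s small but fixed, L^2 smallness
  yields L^1 smallness on a finite measure space.\<close>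

lemma (in finite_measure) integral_norm_le_square:
  fixes f :: "'a \<Rightarrow> 'b::{banach, second_countable_topology}"
  assumes "integrable M (\<lambda>x. norm (f x))" "integrable M (\<lambda>x. (norm (f x))\<^sup>2)" "s > 0"
  shows "(LINT x|M. norm (f x)) \<le> s * measure M (space M) + (LINT x|M. (norm (f x))\<^sup>2) / s"
proof -
  have "(LINT x|M. norm (f x)) \<le> (LINT x|M. s + (norm (f x))\<^sup>2 / s)"
  proof (rule integral_mono)
    show "norm (f x) \<le> s + (norm (f x))\<^sup>2 / s" for x
    proof -
      have "norm (f x) * s \<le> s * s + (norm (f x))\<^sup>2"
        using sum_squares_bound[of "norm (f x)" s] mult_nonneg_nonneg[OF norm_ge_zero[of "f x"], of s] assms(3)
        unfolding power2_eq_square by linarith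
      then show ?thesis using assms(3) by (simp add: field_simps power2_eq_square)
    qed
  qed (use assms in auto)
  also have "\<dots> = s * measure M (space M) + (LINT x|M. (norm (f x))\<^sup>2) / s"
    using assms by (simp add: mult.commute)
  finally show ?thesis .
qed

text \<open>Subtracting \<open>c\<close> makes the sequence increasing and bounded above. The errors
  enter as increments of a convergent sequence so that they telescope.\<close>

lemma convergent_of_almost_incseq:
  fixes E c :: "nat \<Rightarrow> real"
  assumes "\<And>k. E k \<le> E (Suc k) + (c k - c (Suc k))" "convergent c" "\<And>k. E k \<le> B"
  shows "convergent E"
proof -
  have inc: "incseq (\<lambda>k. E k - c k)"
    using assms(1) by (intro incseq_SucI) (simp add: algebra_simps)
  obtain D where D: "\<And>k. \<bar>c k\<bar> \<le> D"
    using convergent_imp_Bseq[OF assms(2)] by (auto simp: Bseq_def)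
  have "E k - c k \<le> B + D" for k using assms(3)[of k] D[of k] by linarith
  then obtain l where "(\<lambda>k. E k - c k) \<longlonglongrightarrow> l"
    using incseq_convergent[OF inc, of "B + D"] by blast
  then have "convergent (\<lambda>k. E k - c k)" by (rule convergentI)
  from convergent_add[OF this assms(2)] show ?thesis by simp
qed

section \<open>Strong convergence of the gradients\<close>

context rank_one_direction
begin

text \<open>The maps converge uniformly along the full sequence, the gradients almost everywhere
  only along a subsequence; the result is stated for that subsequence. The almost everywhere limit
  makes it possible to pass to the limit in the nonlinear defect 1 - |U|^2.\<close>

lemma convergent_approximation:
  assumes w0: "admissible w0" and \<tau>: "\<tau> > 0" and ne: "\<Omega> \<noteq> {}"
  obtains w W G where
    "\<And>k. admissible (w k)" "\<And>k x. norm (w k x - w0 x) \<le> \<tau>"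
    "\<And>k x. \<exists>\<sigma>. norm (jacobian (w k) (at x) - jacobian w0 (at x) - \<sigma> *\<^sub>R tensor a b) \<le> \<tau>"
    "\<And>x. (\<lambda>k. w k x) \<longlonglongrightarrow> W x" "continuous_on UNIV W"
    "G \<in> borel_measurable borel" "\<And>x. norm (G x) \<le> 1"
    "AE x in lebesgue_on \<Omega>. (\<lambda>k. \<eta> + jacobian (w k) (at x)) \<longlonglongrightarrow> G x"
    "AE x in lebesgue_on \<Omega>. norm (G x) = 1"
proof -
  let ?A = "tensor a b" and ?M = "lebesgue_on \<Omega>"
  interpret finite_measure "lebesgue_on \<Omega>"
    by (rule finite_measure_lebesgue_on[OF lmeasurable_\<Omega>])
  obtain X Y where X: "\<And>k. X k \<in> Cc_inf \<Omega>" "\<And>k x. 0 \<le> X k x" "\<And>k x. X k x \<le> 1"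
    and Y: "\<And>x. (\<lambda>k. X k x) \<longlonglongrightarrow> Y x" "\<And>x. x \<in> \<Omega> \<Longrightarrow> Y x > (0::real)"
    by (rule smooth_cutoff_sequence[OF open_\<Omega> ne]) blast
  obtain w t where seq: "w 0 = w0" "2 * t 0 \<le> \<tau>" "\<And>k. admissible (w k)"
    "\<And>k. t k > 0" "\<And>k. t (Suc k) \<le> t k / 2" "\<And>k. almost_orthogonal (w k) (t k) ((1/2) ^ k)"
    "\<And>k x. norm (w (Suc k) x - w k x) \<le> t k"
    "\<And>k x. \<exists>\<sigma>. norm (jacobian (w (Suc k)) (at x) - jacobian (w k) (at x) - \<sigma> *\<^sub>R tensor a b) \<le> t k"
    "\<And>k. (LINT x|lebesgue_on \<Omega>. (X k x * (1 - (norm (\<eta> + jacobian (w k) (at x)))\<^sup>2))\<^sup>2) / 32 - t k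
      \<le> (LINT x|lebesgue_on \<Omega>. (norm (jacobian (w (Suc k)) (at x) - jacobian (w k) (at x)))\<^sup>2)"
    by (rule approximating_sequence[OF w0 \<tau> X]) (rule that; assumption)
  have t_le: "t k \<le> t 0 * (1/2) ^ k" for k
  proof (induction k)
    case (Suc k)
    then show ?case using seq(5)[of k] by simp
  qed simp
  have t_lim: "t \<longlonglongrightarrow> 0"
  proof (rule tendsto_sandwich[OF _ _ tendsto_const])
    show "(\<lambda>k. t 0 * (1/2) ^ k) \<longlonglongrightarrow> 0"
      by (intro tendsto_mult_right_zero LIMSEQ_realpow_zero) auto
  qed (use t_le seq(4) less_imp_le in \<open>auto intro!: always_eventually\<close>)
  have wC: "w k \<in> Cc_inf \<Omega>" and sw: "smooth (w k)" for k
    using seq(3)[of k] Cc_inf_imp_smooth[of "w k" \<Omega>] by (auto simp: admissible_def)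
  \<comment> \<open>Halving gives t l \<le> 2 t l - 2 t (l + 1), so the difference on the right
    telescopes; the same device is used for the distance to the line.\<close>
  have d: "norm (w l x - w k x) \<le> 2 * t k - 2 * t l" if "k \<le> l" for k l x
    using that
  proof (induction l rule: dec_induct)
    case (step l)
    have "norm (w (Suc l) x - w k x) \<le> norm (w (Suc l) x - w l x) + norm (w l x - w k x)"
      using norm_triangle_ineq[of "w (Suc l) x - w l x" "w l x - w k x"] by simp
    with step(3) seq(7)[of l x] seq(5)[of l] show ?case by linarith
  qed simp
  have d2: "norm (w l x - w k x) \<le> 2 * t k" if "k \<le> l" for k l x
    using d[OF that, of x] seq(4)[of l] by linarith
  have line: "\<exists>\<sigma>. norm (jacobian (w k) (at x) - jacobian w0 (at x) - \<sigma> *\<^sub>R ?A) \<le> 2 * t 0 - 2 * t k" for k x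
  proof (induction k)
    case 0 show ?case using seq(1) by (intro exI[of _ 0]) simp
  next
    case (Suc k)
    then obtain \<sigma> where \<sigma>: "norm (jacobian (w k) (at x) - jacobian w0 (at x) - \<sigma> *\<^sub>R ?A) \<le> 2 * t 0 - 2 * t k" by blast
    obtain \<sigma>' where \<sigma>': "norm (jacobian (w (Suc k)) (at x) - jacobian (w k) (at x) - \<sigma>' *\<^sub>R ?A) \<le> t k"
      using seq(8) by blast
    have "norm (jacobian (w (Suc k)) (at x) - jacobian w0 (at x) - (\<sigma>' + \<sigma>) *\<^sub>R ?A) \<le> t k + (2 * t 0 - 2 * t k)"
      using norm_triangle_mono[OF \<sigma>' \<sigma>] by (simp add: algebra_simps)
    also have "\<dots> \<le> 2 * t 0 - 2 * t (Suc k)" using seq(5)[of k] by simp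
    finally show ?case by blast
  qed
  define U where "U k x = \<eta> + jacobian (w k) (at x)" for k x
  have U1: "norm (U k x) < 1" for k x using seq(3)[of k] by (simp add: U_def admissible_def)
  have cU: "continuous_on S (U k)" for k S
    unfolding U_def[abs_def] by (intro smooth_imp_continuous_on smooth_add smooth_const smooth_jacobian sw)
  have cX: "continuous_on S (X k)" for k S
    by (intro smooth_imp_continuous_on Cc_inf_imp_smooth[OF X(1)])
  define E where "E k = (LINT x|?M. (norm (U k x))\<^sup>2)" for k
  \<comment> \<open>Expanding the square leaves the energy difference minus twice U k . (U l - U k).
    Almost orthogonality applies with factor s = 2 because the maps differ by at most
    \<open>2 * t k\<close>; hence 4 = 2 * 2.\<close>
  have orth: "\<bar>(LINT x|?M. (norm (U l x - U k x))\<^sup>2) - (E l - E k)\<bar> \<le> 4 * (1/2) ^ k" if "k \<le> l" for k l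
  proof -
    let ?z = "\<lambda>x. w l x - w k x"
    have J: "jacobian ?z (at x) = U l x - U k x" for x
      using jacobian_diff[OF sw sw] by (simp add: U_def)
    have "\<bar>LINT x|?M. (\<eta> + jacobian (w k) (at x)) \<bullet> jacobian ?z (at x)\<bar> \<le> 2 * (1/2) ^ k"
      by (rule seq(6)[unfolded almost_orthogonal_def, rule_format, OF Cc_inf_diff[OF wC wC]])
        (use d2[OF that] in auto)
    then have o: "\<bar>LINT x|?M. U k x \<bullet> (U l x - U k x)\<bar> \<le> 2 * (1/2) ^ k"
      unfolding J by (simp add: U_def)
    have "(LINT x|?M. (norm (U l x - U k x))\<^sup>2)
      = (LINT x|?M. (norm (U l x))\<^sup>2 - (norm (U k x))\<^sup>2 - 2 * (U k x \<bullet> (U l x - U k x)))"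
      by (simp add: power2_norm_eq_inner inner_diff_left inner_diff_right inner_commute algebra_simps)
    also have "\<dots> = E l - E k - 2 * (LINT x|?M. U k x \<bullet> (U l x - U k x))"
      unfolding E_def
      by (subst Bochner_Integration.integral_diff Bochner_Integration.integral_mult_right_zero,
          (intro integrable_\<Omega> continuous_intros cU)+)+ simp
    finally show ?thesis using o by linarith
  qed
  have E_le: "E k \<le> measure ?M (space ?M)" for k
  proof -
    have "E k \<le> (LINT x|?M. 1)"
      unfolding E_def
      by (rule integral_mono)
        (use U1 in \<open>auto intro!: integrable_\<Omega> continuous_intros cU simp: power_le_one less_imp_le\<close>)
    then show ?thesis by simp
  qed
  have "convergent E"
  proof (rule convergent_of_almost_incseq[OF _ _ E_le])
    fix k
    have "0 \<le> (LINT x|?M. (norm (U (Suc k) x - U k x))\<^sup>2)" by simp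
    \<comment> \<open>The error 4 / 2^k is written as an increment of 8 / 2^k, the form required for
      telescoping.\<close>
    then show "E k \<le> E (Suc k) + (8 * (1/2) ^ k - 8 * (1/2) ^ Suc k)"
      using orth[of k "Suc k"] le_SucI[OF order_refl, of k] unfolding power_Suc by linarith
    have "(\<lambda>k. 8 * (1/2::real) ^ k) \<longlonglongrightarrow> 0"
      by (intro tendsto_mult_right_zero LIMSEQ_realpow_zero) auto
    then show "convergent (\<lambda>k. 8 * (1/2::real) ^ k)" by (rule convergentI)
  qed
  then have cE: "Cauchy E" by (rule convergent_Cauchy)
  have L2: "\<exists>N. \<forall>k\<ge>N. \<forall>l\<ge>N. (LINT x|?M. (norm (U l x - U k x))\<^sup>2) < e" if e: "e > 0" for e
  proof -
    have "(\<lambda>k. 4 * (1/2::real) ^ k) \<longlonglongrightarrow> 0"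
      by (intro tendsto_mult_right_zero LIMSEQ_realpow_zero) auto
    then have "\<forall>\<^sub>F k in sequentially. 4 * (1/2::real) ^ k < e / 2"
      by (rule order_tendstoD(2)) (use e in simp)
    then obtain N1 where N1: "\<And>k. k \<ge> N1 \<Longrightarrow> 4 * (1/2::real) ^ k < e / 2"
      unfolding eventually_sequentially by blast
    obtain N2 where N2: "\<And>k l. k \<ge> N2 \<Longrightarrow> l \<ge> N2 \<Longrightarrow> \<bar>E l - E k\<bar> < e / 2"
      using CauchyD[OF cE half_gt_zero[OF e]] unfolding real_norm_def by blast
    have *: "(LINT x|?M. (norm (U l x - U k x))\<^sup>2) < e" if "max N1 N2 \<le> k" "k \<le> l" for k l
      using orth[OF that(2)] N1[of k] N2[of k l] that by linarith
    have "(LINT x|?M. (norm (U l x - U k x))\<^sup>2) < e" if "max N1 N2 \<le> k" "max N1 N2 \<le> l" for k l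
      using *[of k l] *[of l k] that by (cases "k \<le> l") (auto simp: norm_minus_commute)
    then show ?thesis by blast
  qed
  let ?\<mu> = "measure ?M (space ?M)"
  have L1: "\<exists>N. \<forall>k\<ge>N. \<forall>l\<ge>N. (LINT x|?M. norm (U k x - U l x)) < e" if e: "e > 0" for e
  proof -
    \<comment> \<open>This gives s (\<mu> + 1) = e / 2, so the measure term stays below e / 2; the
      L^2 tolerance s e / 2 controls the other half. The added 1 avoids division by zero.\<close>
    define s where "s = e / (2 * (?\<mu> + 1))"
    have s: "s > 0" using e by (simp add: s_def add_nonneg_pos)
    have "e / (2 * y) * y = e / 2" if "y > 0" for y :: real using that by simp
    from this[of "?\<mu> + 1"] have "s * (?\<mu> + 1) = e / 2"
      unfolding s_def using add_nonneg_pos[OF measure_nonneg zero_less_one] by blast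
    then have s2: "s * ?\<mu> < e / 2" using s by (simp add: distrib_left)
    obtain N where N: "\<And>k l. k \<ge> N \<Longrightarrow> l \<ge> N \<Longrightarrow> (LINT x|?M. (norm (U l x - U k x))\<^sup>2) < s * (e / 2)"
      using L2[of "s * (e / 2)"] s e by auto
    have "(LINT x|?M. norm (U k x - U l x)) < e" if "k \<ge> N" "l \<ge> N" for k l
    proof -
      have "(LINT x|?M. norm (U k x - U l x)) \<le> s * ?\<mu> + (LINT x|?M. (norm (U k x - U l x))\<^sup>2) / s"
        by (intro integral_norm_le_square s integrable_\<Omega> continuous_intros cU)
      moreover have "(LINT x|?M. (norm (U k x - U l x))\<^sup>2) / s < e / 2"
        using N[OF that(2,1)] s by (simp add: pos_divide_less_eq mult.commute)
      ultimately show ?thesis using s2 by linarith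
    qed
    then show ?thesis by blast
  qed
  obtain r where r: "strict_mono r" "AE x in ?M. Cauchy (\<lambda>i. U (r i) x)"
    by (rule cauchy_L1_AE_cauchy_subseq[of ?M U, OF integrable_\<Omega>[OF cU] L1], assumption, rule that)
  define G0 where "G0 x = lim (\<lambda>i. U (r i) x)" for x
  \<comment> \<open>The truncation changes the limit only on a null set, as limits of the U k have
    norm at most 1. It makes the bound hold at every point while keeping Borel
    measurability.\<close>
  define G where "G x = (if norm (G0 x) \<le> 1 then G0 x else 0)" for x
  have mU: "U k \<in> borel_measurable borel" for k
    by (rule borel_measurable_continuous_onI[OF cU])
  have mG0: "G0 \<in> borel_measurable borel"
    unfolding G0_def[abs_def] by (rule borel_measurable_lim_metric[OF mU])
  have mG: "G \<in> borel_measurable borel"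
    unfolding G_def[abs_def] using mG0 by measurable
  have limG: "AE x in ?M. (\<lambda>i. U (r i) x) \<longlonglongrightarrow> G x"
    using r(2)
  proof eventually_elim
    case (elim x)
    then have "convergent (\<lambda>i. U (r i) x)" by (simp add: Cauchy_convergent_iff)
    then have l: "(\<lambda>i. U (r i) x) \<longlonglongrightarrow> G0 x" unfolding G0_def convergent_LIMSEQ_iff .
    have "norm (G0 x) \<le> 1"
      by (rule LIMSEQ_le_const2[OF tendsto_norm[OF l]]) (use U1 less_imp_le in blast)
    with l show ?case by (simp add: G_def)
  qed
  have inc: "(\<lambda>k. (LINT x|?M. (norm (U (Suc k) x - U k x))\<^sup>2)) \<longlonglongrightarrow> 0"
  proof (rule LIMSEQ_I)
    fix e :: real assume "e > 0"
    then obtain N where "\<forall>k\<ge>N. \<forall>l\<ge>N. (LINT x|?M. (norm (U l x - U k x))\<^sup>2) < e" using L2 by blast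
    then show "\<exists>N. \<forall>k\<ge>N. norm ((LINT x|?M. (norm (U (Suc k) x - U k x))\<^sup>2) - 0) < e"
      by (intro exI[of _ N]) auto
  qed
  define I where "I k = (LINT x|?M. (X k x * (1 - (norm (U k x))\<^sup>2))\<^sup>2)" for k
  \<comment> \<open>Each step gained energy in proportion to the weighted defect, but consecutive
    gradients are L^2 close, so the gain, and with it the defect, must vanish in the limit.\<close>
  have I0: "I \<longlonglongrightarrow> 0"
  proof (rule tendsto_sandwich[OF _ _ tendsto_const])
    have "(\<lambda>k. 32 * ((LINT x|?M. (norm (U (Suc k) x - U k x))\<^sup>2) + t k)) \<longlonglongrightarrow> 32 * (0 + 0)"
      by (intro tendsto_intros inc t_lim)
    then show "(\<lambda>k. 32 * ((LINT x|?M. (norm (U (Suc k) x - U k x))\<^sup>2) + t k)) \<longlonglongrightarrow> 0" by simp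
    have "I k \<le> 32 * ((LINT x|?M. (norm (U (Suc k) x - U k x))\<^sup>2) + t k)" for k
      using seq(9)[of k] unfolding I_def U_def by simp
    then show "\<forall>\<^sub>F k in sequentially. I k \<le> 32 * ((LINT x|?M. (norm (U (Suc k) x - U k x))\<^sup>2) + t k)"
      by simp
    show "\<forall>\<^sub>F k in sequentially. 0 \<le> I k" by (simp add: I_def)
  qed
  have mX: "X k \<in> borel_measurable borel" for k
    by (rule borel_measurable_continuous_onI[OF cX])
  have mY: "Y \<in> borel_measurable borel"
    by (rule borel_measurable_LIMSEQ_metric[OF mX Y(1)])
  note [measurable] = mX mU mY mG
  have mYG: "(\<lambda>x. (Y x * (1 - (norm (G x))\<^sup>2))\<^sup>2) \<in> borel_measurable ?M"
    by (intro borel_measurable_lebesgue_on) measurable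
  have bound: "norm ((X k x * (1 - (norm (U k x))\<^sup>2))\<^sup>2) \<le> 1" for k x
    using U1[of k x] X by (intro norm_weighted_defect_le_one) (auto simp: less_imp_le)
  have "(\<lambda>i. LINT x|?M. (X (r i) x * (1 - (norm (U (r i) x))\<^sup>2))\<^sup>2) \<longlonglongrightarrow>
      (LINT x|?M. (Y x * (1 - (norm (G x))\<^sup>2))\<^sup>2)"
  proof (rule integral_dominated_convergence[where w = "\<lambda>x. 1"])
    show "AE x in ?M. (\<lambda>i. (X (r i) x * (1 - (norm (U (r i) x))\<^sup>2))\<^sup>2) \<longlonglongrightarrow> (Y x * (1 - (norm (G x))\<^sup>2))\<^sup>2"
      using limG
    proof eventually_elim
      case (elim x)
      have "(\<lambda>i. X (r i) x) \<longlonglongrightarrow> Y x" using LIMSEQ_subseq_LIMSEQ[OF Y(1) r(1)] by (simp add: o_def)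
      then show ?case using elim by (intro tendsto_intros)
    qed
    show "(\<lambda>x. (X (r i) x * (1 - (norm (U (r i) x))\<^sup>2))\<^sup>2) \<in> borel_measurable ?M" for i
      by (intro borel_measurable_lebesgue_on) measurable
  qed (use bound mYG in auto)
  moreover have "(\<lambda>i. LINT x|?M. (X (r i) x * (1 - (norm (U (r i) x))\<^sup>2))\<^sup>2) \<longlonglongrightarrow> 0"
    using LIMSEQ_subseq_LIMSEQ[OF I0 r(1)] by (simp add: o_def I_def)
  ultimately have Z: "(LINT x|?M. (Y x * (1 - (norm (G x))\<^sup>2))\<^sup>2) = 0"
    by (rule LIMSEQ_unique)
  have Y1: "0 \<le> Y x" "Y x \<le> 1" for x
    by (rule LIMSEQ_le_const[OF Y(1)], use X in blast, rule LIMSEQ_le_const2[OF Y(1)], use X in blast)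
  have G1: "norm (G x) \<le> 1" for x by (simp add: G_def)
  have "norm ((Y x * (1 - (norm (G x))\<^sup>2))\<^sup>2) \<le> 1" for x
    using G1[of x] Y1 by (intro norm_weighted_defect_le_one) auto
  then have "integrable ?M (\<lambda>x. (Y x * (1 - (norm (G x))\<^sup>2))\<^sup>2)"
    using mYG by (intro integrable_const_bound[where B=1]) auto
  from integral_nonneg_eq_0_iff_AE[OF this] Z
  have "AE x in ?M. (Y x * (1 - (norm (G x))\<^sup>2))\<^sup>2 = 0" by simp
  then have "AE x in ?M. norm (G x) = 1"
    using AE_space
  proof eventually_elim
    case (elim x)
    then have "x \<in> \<Omega>" by (simp add: space_restrict_space)
    with elim Y(2)[of x] norm_ge_zero[of "G x"] show ?case
      by (auto simp: power2_eq_1_iff simp del: norm_ge_zero)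
  qed
  have "convergent (\<lambda>k. w k x)" for x
  proof -
    have "Cauchy (\<lambda>k. w k x)"
    proof (rule CauchyI')
      fix e :: real assume "e > 0"
      then have "\<forall>\<^sub>F k in sequentially. t k < e / 2"
        by (intro order_tendstoD(2)[OF t_lim]) simp
      then obtain N where N: "\<And>k. k \<ge> N \<Longrightarrow> t k < e / 2"
        unfolding eventually_sequentially by blast
      show "\<exists>M. \<forall>m\<ge>M. \<forall>n>m. dist (w m x) (w n x) < e"
      proof (intro exI[of _ N] allI impI)
        fix m n assume "N \<le> m" "m < n"
        then show "dist (w m x) (w n x) < e"
          using d2[of m n x] N[of m] by (simp add: dist_norm norm_minus_commute)
      qed
    qed
    then show ?thesis by (simp add: Cauchy_convergent_iff)
  qed
  then obtain W where W: "\<And>x. (\<lambda>k. w k x) \<longlonglongrightarrow> W x"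
    unfolding convergent_def by metis
  have Wd: "norm (W x - w k x) \<le> 2 * t k" for x k
    by (rule LIMSEQ_le_const2[OF tendsto_norm[OF tendsto_diff[OF W tendsto_const]]]) (use d2 in blast)
  have "uniform_limit UNIV w W sequentially"
  proof (rule uniform_limitI)
    fix e :: real assume "e > 0"
    then have "\<forall>\<^sub>F k in sequentially. t k < e / 2" using order_tendstoD(2)[OF t_lim, of "e/2"] by simp
    then show "\<forall>\<^sub>F k in sequentially. \<forall>x\<in>UNIV. dist (w k x) (W x) < e"
    proof eventually_elim
      case (elim k)
      show ?case
      proof
        fix x show "dist (w k x) (W x) < e"
          using Wd[of x k] elim by (simp add: dist_norm norm_minus_commute)
      qed
    qed
  qed
  then have cW: "continuous_on UNIV W"
    by (rule uniform_limit_theorem[OF always_eventually, rotated])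
      (auto intro!: smooth_imp_continuous_on sw)
  show thesis
  proof (rule that[of "\<lambda>i. w (r i)" W G])
    show "norm (w (r i) x - w0 x) \<le> \<tau>" for i x
      using d2[of 0 "r i" x] seq(1,2) by simp
    show "\<exists>\<sigma>. norm (jacobian (w (r i)) (at x) - jacobian w0 (at x) - \<sigma> *\<^sub>R ?A) \<le> \<tau>" for i x
    proof -
      obtain \<sigma> where "norm (jacobian (w (r i)) (at x) - jacobian w0 (at x) - \<sigma> *\<^sub>R ?A) \<le> 2 * t 0 - 2 * t (r i)"
        using line by blast
      also have "\<dots> \<le> \<tau>" using seq(2) seq(4)[of "r i"] by linarith
      finally show ?thesis by blast
    qed
    show "(\<lambda>i. w (r i) x) \<longlonglongrightarrow> W x" for x
      using LIMSEQ_subseq_LIMSEQ[OF W r(1)] by (simp add: o_def)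
    show "AE x in lebesgue_on \<Omega>. (\<lambda>k. \<eta> + jacobian (w (r k)) (at x)) \<longlonglongrightarrow> G x"
      using limG by (simp add: U_def)
  qed fact+
qed

end

subsection \<open>Passage to the Sobolev spaces\<close>

lemma norm_matrix_nth_le: "\<bar>\<xi> $ i $ j\<bar> \<le> norm (\<xi> :: real^'n^'m)"
  using component_le_norm_cart[of "\<xi> $ i" j] Finite_Cartesian_Product.norm_nth_le[of \<xi> i] by linarith

text \<open>On a bounded set uniform bounds serve as dominating functions, so both sides of the
  integration by parts formula converge. The bounds are asked for on \<Omega> only, because the
  lemma is also applied to maps containing the affine part, unbounded on the whole space.\<close>

lemma weak_gradient_limit:
  fixes f :: "nat \<Rightarrow> real^'n \<Rightarrow> real^'m"
  assumes \<Omega>: "open \<Omega>" "bounded \<Omega>" and f: "\<And>k. smooth (f k)"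
    and C: "\<And>k x. x \<in> \<Omega> \<Longrightarrow> norm (f k x) \<le> C"
    and D: "\<And>k x. x \<in> \<Omega> \<Longrightarrow> norm (jacobian (f k) (at x)) \<le> D"
    and F: "\<And>x. (\<lambda>k. f k x) \<longlonglongrightarrow> F x" "continuous_on UNIV F"
    and G: "G \<in> borel_measurable borel" "\<And>x. x \<in> \<Omega> \<Longrightarrow> norm (G x) \<le> D"
      "AE x in lebesgue_on \<Omega>. (\<lambda>k. jacobian (f k) (at x)) \<longlonglongrightarrow> G x"
  shows "weak_gradient \<Omega> F G"
  unfolding weak_gradient_def
proof (intro conjI allI impI)
  have m: "\<Omega> \<in> lmeasurable" using \<Omega> by (simp add: lmeasurable_open)
  interpret finite_measure "lebesgue_on \<Omega>" by (rule finite_measure_lebesgue_on[OF m])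
  show "locally_integrable \<Omega> F"
    unfolding locally_integrable_def
    using F(2) by (auto intro!: integrable_continuous_on_bounded lmeasurable_compact compact_imp_bounded)
  show "locally_integrable \<Omega> G"
    unfolding locally_integrable_def
    using G by (auto intro!: integrable_lebesgue_on_bounded[where B=D] lmeasurable_compact borel_measurable_lebesgue_on)
  fix \<phi> :: "real^'n \<Rightarrow> real" and i j assume \<phi>: "\<phi> \<in> Cc_inf \<Omega>"
  have s\<phi>: "smooth \<phi>" by (rule Cc_inf_imp_smooth[OF \<phi>])
  obtain B where B: "\<And>x. norm (\<phi> x) \<le> B" using Cc_inf_bounded[OF \<phi>] by metis
  obtain B' where B': "\<And>x. norm (grad \<phi> x) \<le> B'" using Cc_inf_bounded[OF Cc_inf_grad[OF \<phi>]] by metis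
  have B'': "\<bar>partial_deriv j \<phi> x\<bar> \<le> B'" for x
    using component_le_norm_cart[of "grad \<phi> x" j] B'[of x] by (simp add: grad_def)
  \<comment> \<open>The signs of C and D are forced only by the presence of a point of
    \<Omega>.\<close>
  have pos: "C \<ge> 0 \<and> D \<ge> 0" if "x \<in> \<Omega>" for x
    by (rule conjI[OF order_trans[OF norm_ge_zero C[OF that]] order_trans[OF norm_ge_zero D[OF that]]])
  have cont: "continuous_on UNIV (f k)" "continuous_on UNIV (\<lambda>x. jacobian (f k) (at x))"
    "continuous_on UNIV \<phi>" "continuous_on UNIV (partial_deriv j \<phi>)" for k
    by (intro smooth_imp_continuous_on smooth_jacobian smooth_partial_deriv f s\<phi>)+
  note [measurable] = G(1) borel_measurable_continuous_onI[OF F(2)] borel_measurable_continuous_onI[OF cont(1)]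
    borel_measurable_continuous_onI[OF cont(2)] borel_measurable_continuous_onI[OF cont(3)]
    borel_measurable_continuous_onI[OF cont(4)]
  have nth[measurable]: "(\<lambda>\<xi>. \<xi> $ i) \<in> borel_measurable (borel :: ('b::real_normed_vector ^ 'm) measure)" for i
    by (intro borel_measurable_continuous_onI linear_continuous_on bounded_linear_vec_nth)
  have nth'[measurable]: "(\<lambda>\<xi>. \<xi> $ i) \<in> borel_measurable (borel :: (real ^ 'n) measure)" for i
    by (intro borel_measurable_continuous_onI linear_continuous_on bounded_linear_vec_nth)
  have 1: "(\<lambda>k. LINT x|lebesgue_on \<Omega>. f k x $ i * partial_deriv j \<phi> x) \<longlonglongrightarrow>
      (LINT x|lebesgue_on \<Omega>. F x $ i * partial_deriv j \<phi> x)"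
  proof (rule integral_dominated_convergence[where w = "\<lambda>x. C * B'"])
    show "(\<lambda>x. F x $ i * partial_deriv j \<phi> x) \<in> borel_measurable (lebesgue_on \<Omega>)"
      "(\<lambda>x. f k x $ i * partial_deriv j \<phi> x) \<in> borel_measurable (lebesgue_on \<Omega>)" for k
      by (intro borel_measurable_lebesgue_on; measurable)+
    show "AE x in lebesgue_on \<Omega>. (\<lambda>k. f k x $ i * partial_deriv j \<phi> x) \<longlonglongrightarrow> F x $ i * partial_deriv j \<phi> x"
      by (intro AE_I2 tendsto_intros F)
    show "AE x in lebesgue_on \<Omega>. norm (f k x $ i * partial_deriv j \<phi> x) \<le> C * B'" for k
    proof (rule AE_I2)
      fix x assume "x \<in> space (lebesgue_on \<Omega>)"
      then have x: "x \<in> \<Omega>" by (simp add: space_restrict_space)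
      show "norm (f k x $ i * partial_deriv j \<phi> x) \<le> C * B'"
        unfolding real_norm_def abs_mult
        using component_le_norm_cart[of "f k x" i] C[OF x, of k] B''[of x] pos[OF x]
        by (intro mult_mono) auto
    qed
  qed auto
  have 2: "(\<lambda>k. LINT x|lebesgue_on \<Omega>. jacobian (f k) (at x) $ i $ j * \<phi> x) \<longlonglongrightarrow>
      (LINT x|lebesgue_on \<Omega>. G x $ i $ j * \<phi> x)"
  proof (rule integral_dominated_convergence[where w = "\<lambda>x. D * B"])
    show "(\<lambda>x. G x $ i $ j * \<phi> x) \<in> borel_measurable (lebesgue_on \<Omega>)"
      "(\<lambda>x. jacobian (f k) (at x) $ i $ j * \<phi> x) \<in> borel_measurable (lebesgue_on \<Omega>)" for k
      by (intro borel_measurable_lebesgue_on; measurable)+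
    show "AE x in lebesgue_on \<Omega>. (\<lambda>k. jacobian (f k) (at x) $ i $ j * \<phi> x) \<longlonglongrightarrow> G x $ i $ j * \<phi> x"
      using G(3) by eventually_elim (intro tendsto_intros)
    show "AE x in lebesgue_on \<Omega>. norm (jacobian (f k) (at x) $ i $ j * \<phi> x) \<le> D * B" for k
    proof (rule AE_I2)
      fix x assume "x \<in> space (lebesgue_on \<Omega>)"
      then have x: "x \<in> \<Omega>" by (simp add: space_restrict_space)
      show "norm (jacobian (f k) (at x) $ i $ j * \<phi> x) \<le> D * B"
        unfolding real_norm_def abs_mult
        using norm_matrix_nth_le[of "jacobian (f k) (at x)" i j] D[OF x, of k] B[of x] pos[OF x]
        by (intro mult_mono) auto
    qed
  qed auto
  have ibp: "(LINT x|lebesgue_on \<Omega>. f k x $ i * partial_deriv j \<phi> x)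
    = - (LINT x|lebesgue_on \<Omega>. jacobian (f k) (at x) $ i $ j * \<phi> x)" for k
    using integration_by_parts[OF \<Omega> _ Cc_inf_imp_Cc[OF \<phi>], of "\<lambda>x. f k x $ i" j] smooth_nth[OF f[of k], of i]
    by (simp add: smooth_def jacobian_nth partial_deriv_nth[OF smooth_imp_differentiable[OF f]] del: class_C.simps)
  show "(LINT x|lebesgue_on \<Omega>. F x $ i * partial_deriv j \<phi> x) = - (LINT x|lebesgue_on \<Omega>. G x $ i $ j * \<phi> x)"
    using LIMSEQ_unique[OF 1 tendsto_minus[OF 2, folded ibp]] .
qed

lemma Linf_of_bounded:
  fixes f :: "real^'n \<Rightarrow> 'b::real_normed_vector"
  assumes "open \<Omega>" "f \<in> borel_measurable borel" "\<And>x. x \<in> \<Omega> \<Longrightarrow> norm (f x) \<le> B"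
  shows "Linf_norm \<Omega> f \<le> ereal B" "f \<in> Linf \<Omega>"
proof -
  have [measurable]: "f \<in> borel_measurable (lebesgue_on \<Omega>)"
    using assms(2) by (intro measurable_restrict_space1 measurable_completion) simp
  show le: "Linf_norm \<Omega> f \<le> ereal B"
    unfolding Linf_norm_def
    by (rule esssup_I) (use assms in \<open>auto simp: space_restrict_space\<close>)
  then show "f \<in> Linf \<Omega>" by (auto simp: Linf_def)
qed

text \<open>The set of disagreement is open and negligible, hence empty. Values of continuous
  representatives at a single point can thus distinguish equivalence classes.\<close>

lemma AE_lebesgue_on_eq_imp_eq:
  fixes f g :: "real^'n \<Rightarrow> real^'m"
  assumes "open \<Omega>" "continuous_on UNIV f" "continuous_on UNIV g"
    "AE x in lebesgue_on \<Omega>. f x = g x" "x \<in> \<Omega>"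
  shows "f x = g x"
proof (rule ccontr)
  assume "f x \<noteq> g x"
  let ?S = "{x \<in> \<Omega>. f x \<noteq> g x}"
  have o: "open ?S"
    using open_Int[OF assms(1) open_Collect_neq[OF assms(2,3)]] by (simp add: Collect_conj_eq)
  have "AE x in lebesgue. x \<in> \<Omega> \<longrightarrow> f x = g x"
    using assms(1,4) by (subst (asm) AE_restrict_space_iff) auto
  then have "AE x in lebesgue. x \<notin> ?S" by eventually_elim blast
  then have "?S \<in> null_sets lebesgue"
    using o by (subst AE_iff_null_sets) auto
  then have "negligible ?S" by (simp add: negligible_iff_null_sets)
  moreover have "?S \<noteq> {}" using \<open>f x \<noteq> g x\<close> assms(5) by blast
  ultimately show False using open_not_negligible[OF o] by blast
qed

section \<open>Sobolev solutions near an admissible starting map\<close>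

context rank_one_direction
begin

text \<open>Nearness is recorded as distance to the line, a closed condition that all approximating
  gradients satisfy and the limit inherits. Nearness to the two points on the sphere is available
  only afterwards, once the limit has norm 1. Here \<delta> accounts for the gradient of the start
  and \<tau> for all later waves.\<close>

lemma exact_solution:
  fixes \<gamma> :: "real^'m"
  assumes w0: "admissible w0" and \<tau>: "\<tau> > 0" and ne: "\<Omega> \<noteq> {}"
    and \<delta>: "\<And>x. norm (jacobian w0 (at x)) \<le> \<delta>" and B: "\<And>x. norm (w0 x) \<le> B"
  defines "v \<equiv> \<lambda>x. \<eta> *v x + \<gamma>"
  obtains u G where "continuous_on UNIV u" "\<And>x. norm (u x - v x - w0 x) \<le> \<tau>"
    "u \<in> W1_inf \<Omega>" "weak_gradient \<Omega> u G" "eq_on_boundary \<Omega> u v"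
    "Linf_norm \<Omega> (\<lambda>x. u x - v x) \<le> ereal (B + \<tau>)"
    "AE x in lebesgue_on \<Omega>. norm (G x) = 1"
    "AE x in lebesgue_on \<Omega>. lin_fun L (G x) = lin_fun L \<eta>"
    "AE x in lebesgue_on \<Omega>. infdist (G x) (range (\<lambda>\<sigma>. \<eta> + \<sigma> *\<^sub>R tensor a b)) \<le> \<delta> + \<tau>"
proof -
  obtain w W G where w: "\<And>k. admissible (w k)" "\<And>k x. norm (w k x - w0 x) \<le> \<tau>"
    "\<And>k x. \<exists>\<sigma>. norm (jacobian (w k) (at x) - jacobian w0 (at x) - \<sigma> *\<^sub>R tensor a b) \<le> \<tau>"
    and W: "\<And>x. (\<lambda>k. w k x) \<longlonglongrightarrow> W x" "continuous_on UNIV W"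
    and G: "G \<in> borel_measurable borel" "\<And>x. norm (G x) \<le> 1"
    "AE x in lebesgue_on \<Omega>. (\<lambda>k. \<eta> + jacobian (w k) (at x)) \<longlonglongrightarrow> G x"
    "AE x in lebesgue_on \<Omega>. norm (G x) = 1"
    by (rule convergent_approximation[OF w0 \<tau> ne]) (rule that; assumption)
  interpret finite_measure "lebesgue_on \<Omega>"
    by (rule finite_measure_lebesgue_on[OF lmeasurable_\<Omega>])
  have wC: "w k \<in> Cc_inf \<Omega>" "norm (\<eta> + jacobian (w k) (at x)) < 1" "lin_fun L (jacobian (w k) (at x)) = 0" for k x
    using w(1)[of k] by (auto simp: admissible_def)
  have sw: "smooth (w k)" for k by (rule Cc_inf_imp_smooth[OF wC(1)])
  have wB: "norm (w k x) \<le> B + \<tau>" for k x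
    using norm_triangle_ineq[of "w0 x" "w k x - w0 x"] w(2)[of k x] B[of x] by simp
  have WB: "norm (W x) \<le> B + \<tau>" for x
    by (rule LIMSEQ_le_const2[OF tendsto_norm[OF W(1)]]) (use wB in blast)
  have J2: "norm (jacobian (w k) (at x)) \<le> 2" for k x
    using norm_triangle_ineq4[of "\<eta> + jacobian (w k) (at x)" \<eta>] wC(2)[of k x] norm_\<eta> by simp
  define H where "H x = G x - \<eta>" for x
  have mH: "H \<in> borel_measurable borel" unfolding H_def[abs_def] using G(1) by measurable
  have H2: "norm (H x) \<le> 2" for x
    using norm_triangle_ineq4[of "G x" \<eta>] G(2)[of x] norm_\<eta> by (simp add: H_def)
  have limH: "AE x in lebesgue_on \<Omega>. (\<lambda>k. jacobian (w k) (at x)) \<longlonglongrightarrow> H x"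
    using G(3)
  proof eventually_elim
    case (elim x)
    from tendsto_diff[OF this tendsto_const[of \<eta>]] show ?case by (simp add: H_def)
  qed
  have wgW: "weak_gradient \<Omega> W H"
    by (rule weak_gradient_limit[OF open_\<Omega> bounded_\<Omega> sw wB J2 W mH H2 limH])
  have sv: "smooth v"
    unfolding v_def
    by (intro smooth_add smooth_const smooth_linear[OF _ smooth_ident] matrix_vector_mul_bounded_linear)
  have Jv: "jacobian v (at x) = \<eta>" for x
  proof -
    have "(v has_derivative (\<lambda>h. \<eta> *v h)) (at x)"
      unfolding v_def
      by (auto intro!: derivative_eq_intros bounded_linear.has_derivative[OF matrix_vector_mul_bounded_linear])
    from partial_deriv_eq[OF this] show ?thesis
      by (simp add: vec_eq_iff jacobian_nth matrix_vector_mult_basis column_def)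
  qed
  obtain R where R: "\<And>x. x \<in> \<Omega> \<Longrightarrow> norm (v x) \<le> R"
  proof -
    have "bounded (v ` closure \<Omega>)"
      using bounded_\<Omega> by (intro compact_imp_bounded compact_continuous_image smooth_imp_continuous_on[OF sv]) simp
    then show thesis using that closure_subset unfolding bounded_iff by blast
  qed
  define u where "u x = v x + W x" for x
  have cu: "continuous_on UNIV u"
    unfolding u_def[abs_def] by (intro continuous_intros smooth_imp_continuous_on[OF sv] W(2))
  have wgu: "weak_gradient \<Omega> u G"
  proof (rule weak_gradient_limit[OF open_\<Omega> bounded_\<Omega>, of "\<lambda>k x. v x + w k x" "R + (B + \<tau>)" 1])
    fix k x assume x: "x \<in> \<Omega>"
    show "norm (v x + w k x) \<le> R + (B + \<tau>)"
      by (rule norm_triangle_mono[OF R[OF x] wB])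
    show "norm (jacobian (\<lambda>x. v x + w k x) (at x)) \<le> 1"
      using wC(2)[of k x] by (simp add: jacobian_add[OF sv sw] Jv)
  next
    show "AE x in lebesgue_on \<Omega>. (\<lambda>k. jacobian (\<lambda>x. v x + w k x) (at x)) \<longlonglongrightarrow> G x"
      using G(3) by (simp add: jacobian_add[OF sv sw] Jv)
    show "(\<lambda>k. v x + w k x) \<longlonglongrightarrow> u x" for x
      unfolding u_def by (intro tendsto_intros W(1))
  qed (use G cu in \<open>auto intro: smooth_add sv sw\<close>)
  have uW: "(\<lambda>x. u x - v x) = W" by (simp add: u_def)
  have mW: "W \<in> borel_measurable borel" by (rule borel_measurable_continuous_onI[OF W(2)])
  \<comment> \<open>The iterates themselves are the required compactly supported functions: bounded
    and convergent almost everywhere with their gradients, they converge in W^{1,1}.\<close>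
  have W11: "W \<in> W1_1_0 \<Omega>"
    unfolding W1_1_0_def mem_Collect_eq
  proof (intro conjI exI)
    show iW: "integrable (lebesgue_on \<Omega>) W" by (rule integrable_\<Omega>[OF W(2)])
    show "weak_gradient \<Omega> W H" by (rule wgW)
    show iH: "integrable (lebesgue_on \<Omega>) H"
      by (rule integrable_lebesgue_on_bounded[OF lmeasurable_\<Omega> borel_measurable_lebesgue_on[OF mH] H2])
    show "\<forall>k. w k \<in> Cc 1 \<Omega>" using Cc_inf_imp_Cc[OF wC(1)] by blast
    have "(\<lambda>k. LINT x|lebesgue_on \<Omega>. norm (w k x - W x)) \<longlonglongrightarrow> (LINT x|lebesgue_on \<Omega>. norm (0 :: real^'m))"
    proof (rule integral_dominated_convergence[where w = "\<lambda>x. (B + \<tau>) + (B + \<tau>)"])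
      show "(\<lambda>x. norm (w k x - W x)) \<in> borel_measurable (lebesgue_on \<Omega>)" for k
        by (intro borel_measurable_lebesgue_on borel_measurable_continuous_onI continuous_intros
            smooth_imp_continuous_on[OF sw] W(2))
      show "AE x in lebesgue_on \<Omega>. (\<lambda>k. norm (w k x - W x)) \<longlonglongrightarrow> norm (0 :: real^'m)"
        by (intro AE_I2 tendsto_norm LIM_zero W(1))
      show "AE x in lebesgue_on \<Omega>. norm (norm (w k x - W x)) \<le> (B + \<tau>) + (B + \<tau>)" for k
      proof (rule AE_I2)
        fix x show "norm (norm (w k x - W x)) \<le> (B + \<tau>) + (B + \<tau>)"
          using norm_triangle_ineq4[of "w k x" "W x"] wB[of k x] WB[of x]
          unfolding real_norm_def abs_norm_cancel by linarith
      qed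
    qed auto
    then show "(\<lambda>k. LINT x|lebesgue_on \<Omega>. norm (w k x - W x)) \<longlonglongrightarrow> 0" by simp
    have "(\<lambda>k. LINT x|lebesgue_on \<Omega>. norm (jacobian (w k) (at x) - H x)) \<longlonglongrightarrow> (LINT x|lebesgue_on \<Omega>. norm (0 :: real^'n^'m))"
    proof (rule integral_dominated_convergence[where w = "\<lambda>x. 4"])
      show "(\<lambda>x. norm (jacobian (w k) (at x) - H x)) \<in> borel_measurable (lebesgue_on \<Omega>)" for k
      proof -
        note [measurable] = mH
          borel_measurable_continuous_onI[OF smooth_imp_continuous_on[OF smooth_jacobian[OF sw[of k]]]]
        show ?thesis by (intro borel_measurable_lebesgue_on) measurable
      qed
      show "AE x in lebesgue_on \<Omega>. (\<lambda>k. norm (jacobian (w k) (at x) - H x)) \<longlonglongrightarrow> norm (0 :: real^'n^'m)"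
        using limH by eventually_elim (intro tendsto_norm LIM_zero)
      show "AE x in lebesgue_on \<Omega>. norm (norm (jacobian (w k) (at x) - H x)) \<le> 4" for k
      proof (rule AE_I2)
        fix x show "norm (norm (jacobian (w k) (at x) - H x)) \<le> 4"
          using norm_triangle_ineq4[of "jacobian (w k) (at x)" "H x"] J2[of k x] H2[of x]
          unfolding real_norm_def abs_norm_cancel by linarith
      qed
    qed auto
    then show "(\<lambda>k. LINT x|lebesgue_on \<Omega>. norm (jacobian (w k) (at x) - H x)) \<longlonglongrightarrow> 0" by simp
  qed
  have "W \<in> W1_inf \<Omega>"
    unfolding W1_inf_def
    using Linf_of_bounded(2)[OF open_\<Omega> mW WB] Linf_of_bounded(2)[OF open_\<Omega> mH H2] wgW by blast
  with W11 have bd: "eq_on_boundary \<Omega> u v"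
    by (simp add: eq_on_boundary_def W1_inf_0_def uW)
  have uB: "norm (u x) \<le> R + (B + \<tau>)" if "x \<in> \<Omega>" for x
    unfolding u_def by (rule norm_triangle_mono[OF R[OF that] WB])
  have u_in: "u \<in> W1_inf \<Omega>"
    unfolding W1_inf_def
    using Linf_of_bounded(2)[OF open_\<Omega> borel_measurable_continuous_onI[OF cu] uB]
      Linf_of_bounded(2)[OF open_\<Omega> G(1) G(2)] wgu by blast
  let ?l = "range (\<lambda>\<sigma>. \<eta> + \<sigma> *\<^sub>R tensor a b)"
  \<comment> \<open>Compare with the point of the line having the accumulated coefficient \<sigma>;
    the rest is the starting gradient plus the total error.\<close>
  have near: "infdist (\<eta> + jacobian (w k) (at x)) ?l \<le> \<delta> + \<tau>" for k x
  proof -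
    obtain \<sigma> where \<sigma>: "norm (jacobian (w k) (at x) - jacobian w0 (at x) - \<sigma> *\<^sub>R tensor a b) \<le> \<tau>"
      using w(3) by blast
    have "infdist (\<eta> + jacobian (w k) (at x)) ?l \<le> dist (\<eta> + jacobian (w k) (at x)) (\<eta> + \<sigma> *\<^sub>R tensor a b)"
      by (rule infdist_le) blast
    also have "\<dots> \<le> \<delta> + \<tau>"
      using norm_triangle_mono[OF \<delta>[of x] \<sigma>] by (simp add: dist_norm algebra_simps)
    finally show ?thesis .
  qed
  show thesis
  proof (rule that[OF cu _ u_in wgu bd])
    show "norm (u x - v x - w0 x) \<le> \<tau>" for x
    proof -
      have "norm (W x - w0 x) \<le> \<tau>"
        by (rule LIMSEQ_le_const2[OF tendsto_norm[OF tendsto_diff[OF W(1) tendsto_const]]]) (use w(2) in blast)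
      then show ?thesis by (simp add: u_def)
    qed
    show "Linf_norm \<Omega> (\<lambda>x. u x - v x) \<le> ereal (B + \<tau>)"
      unfolding uW by (rule Linf_of_bounded(1)[OF open_\<Omega> mW WB])
    show "AE x in lebesgue_on \<Omega>. norm (G x) = 1" by (rule G(4))
    show "AE x in lebesgue_on \<Omega>. lin_fun L (G x) = lin_fun L \<eta>"
      using G(3)
    proof eventually_elim
      case (elim x)
      have "(\<lambda>k. L \<bullet> (\<eta> + jacobian (w k) (at x))) \<longlonglongrightarrow> L \<bullet> G x" by (intro tendsto_intros elim)
      moreover have "L \<bullet> (\<eta> + jacobian (w k) (at x)) = L \<bullet> \<eta>" for k
        using wC(3)[of k x] by (simp add: lin_fun_eq_inner inner_add_right)
      ultimately show ?case by (simp add: lin_fun_eq_inner LIMSEQ_const_iff)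
    qed
    show "AE x in lebesgue_on \<Omega>. infdist (G x) ?l \<le> \<delta> + \<tau>"
      using G(3)
    proof eventually_elim
      case (elim x)
      show ?case
        by (rule LIMSEQ_le_const2[OF tendsto_infdist[OF elim]]) (use near in blast)
    qed
  qed
qed

text \<open>This supplies a perturbation satisfying the linear constraint with a nonzero value at a
  known point, the quantity by which the solutions are later told apart.\<close>

lemma potential_nonzero:
  assumes "\<Omega> \<noteq> {}"
  obtains f x where "f \<in> Cc_inf \<Omega>" "x \<in> \<Omega>" "potential f x \<noteq> 0"
proof -
  obtain c r where r: "r > 0" "cball c r \<subseteq> \<Omega>"
    using assms open_\<Omega> open_contains_cball by blast
  have p: "p \<noteq> 0" using p_b Lb_nz by auto
  \<comment> \<open>The bump is critical at its centre; halfway out in direction p its gradient is a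
    negative multiple of p, so its p-component is nonzero.\<close>
  define x where "x = c + (r / (2 * norm p)) *\<^sub>R p"
  have nx: "norm (x - c) = r / 2" using p r by (simp add: x_def)
  define \<beta> where "\<beta> = flat 2 (r\<^sup>2 - (x - c) \<bullet> (x - c))"
  have "(x - c) \<bullet> (x - c) = r\<^sup>2 / 4" unfolding dot_square_norm nx by (simp add: power_divide)
  moreover have "r\<^sup>2 > 0" using r by simp
  ultimately have "(x - c) \<bullet> (x - c) < r\<^sup>2" by linarith
  then have \<beta>: "\<beta> > 0" by (simp add: \<beta>_def flat_def)
  have "(bump c r has_derivative (\<lambda>h. (- 2 * \<beta>) *\<^sub>R (x - c) \<bullet> h)) (at x)"
  proof -
    have "((\<lambda>x. r\<^sup>2 - (x - c) \<bullet> (x - c)) has_derivative (\<lambda>h. - 2 * ((x - c) \<bullet> h))) (at x)"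
      by (auto intro!: derivative_eq_intros simp: inner_commute algebra_simps)
    from has_derivative_compose[OF this flat_deriv[of 0, unfolded has_field_derivative_def]]
    show ?thesis by (simp add: bump_def[abs_def] \<beta>_def numeral_2_eq_2 algebra_simps)
  qed
  then have g: "grad (bump c r) x = (- 2 * \<beta>) *\<^sub>R (x - c)" by (rule grad_eq)
  have "p \<bullet> grad (bump c r) x = - \<beta> * r * norm p"
    unfolding g using p by (simp add: x_def dot_square_norm power2_eq_square)
  then have "p \<bullet> grad (bump c r) x \<noteq> 0" using \<beta> r p by simp
  \<comment> \<open>a and Lb are orthogonal, since a . Lb = q . b = 0; pairing with a isolates the
    first term of the potential.\<close>
  moreover have "a \<bullet> potential (bump c r) x = (p \<bullet> grad (bump c r) x) * (a \<bullet> a)"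
    using q_b by (simp add: potential_def inner_diff_right dot_lmul_matrix)
  ultimately have "potential (bump c r) x \<noteq> 0" using a_nz by auto
  moreover have "bump c r \<in> Cc_inf \<Omega>"
    using r by (intro Cc_infI[where K = "cball c r"] smooth_bump) (auto simp: bump_eq_0)
  moreover have "x \<in> \<Omega>" using r nx by (auto simp: dist_norm norm_minus_commute)
  ultimately show thesis using that by blast
qed

end

section \<open>The line and the unit sphere\<close>

text \<open>Completing the square turns the equation into (N s + m)^2 = D. As |\<eta>| < 1 gives D >
  m^2, the two roots have opposite signs.\<close>

lemma unit_sphere_line_roots:
  fixes \<eta> A :: "'a::real_inner"
  assumes "norm \<eta> < 1" "A \<noteq> 0"
  obtains sp sm :: real where "sp > 0" "sm < 0" "\<And>s. norm (\<eta> + s *\<^sub>R A) = 1 \<longleftrightarrow> s = sp \<or> s = sm"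
proof -
  define N where "N = A \<bullet> A"
  define m where "m = \<eta> \<bullet> A"
  define D where "D = m\<^sup>2 + N * (1 - \<eta> \<bullet> \<eta>)"
  have N: "N > 0" using assms by (simp add: N_def)
  have "\<eta> \<bullet> \<eta> < 1" using assms by (simp add: dot_square_norm power_less_one_iff)
  then have D: "D > m\<^sup>2" using N by (simp add: D_def)
  then have D0: "D > 0" using zero_le_power2[of m] by linarith
  have sq: "\<bar>m\<bar> < sqrt D" using D real_sqrt_less_mono[of "m\<^sup>2" D] by simp
  show thesis
  proof (rule that)
    show "(sqrt D - m) / N > 0" "(- sqrt D - m) / N < 0"
      using sq N by (auto intro!: divide_pos_pos divide_neg_pos)
    fix s
    have "norm (\<eta> + s *\<^sub>R A) = 1 \<longleftrightarrow> (\<eta> + s *\<^sub>R A) \<bullet> (\<eta> + s *\<^sub>R A) = 1"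
      by (simp add: norm_eq_1)
    also have "(\<eta> + s *\<^sub>R A) \<bullet> (\<eta> + s *\<^sub>R A) = \<eta> \<bullet> \<eta> + 2 * s * m + s\<^sup>2 * N"
      by (simp add: N_def m_def inner_add_left inner_add_right inner_commute power2_eq_square algebra_simps)
    also have "\<dots> = 1 \<longleftrightarrow> N * (\<eta> \<bullet> \<eta> + 2 * s * m + s\<^sup>2 * N) = N * 1" using N by simp
    also have "\<dots> \<longleftrightarrow> (N * s + m)\<^sup>2 = (sqrt D)\<^sup>2"
      using D0 by (auto simp: D_def power2_eq_square algebra_simps)
    also have "\<dots> \<longleftrightarrow> N * s + m = sqrt D \<or> N * s + m = - sqrt D" by (rule power2_eq_iff)
    also have "\<dots> \<longleftrightarrow> s = (sqrt D - m) / N \<or> s = (- sqrt D - m) / N"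
      using N by (auto simp: field_simps)
    finally show "norm (\<eta> + s *\<^sub>R A) = 1 \<longleftrightarrow> s = (sqrt D - m) / N \<or> s = (- sqrt D - m) / N" .
  qed
qed

text \<open>The points of the sphere at distance at least \<epsilon> from both roots form a compact
  set disjoint from the closed line, hence at positive distance from it. Half of that distance
  serves as \<open>d\<close>, to turn a weak inequality into a strict one.\<close>

lemma near_line_and_sphere:
  fixes \<eta> A :: "'a::euclidean_space"
  assumes roots: "\<And>s. norm (\<eta> + s *\<^sub>R A) = 1 \<longleftrightarrow> s = sp \<or> s = sm" and "\<epsilon> > 0"
  obtains d where "d > 0" "\<And>\<xi>. norm \<xi> = 1 \<Longrightarrow> infdist \<xi> (range (\<lambda>\<sigma>. \<eta> + \<sigma> *\<^sub>R A)) \<le> d \<Longrightarrow>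
    infdist \<xi> {\<eta> + sp *\<^sub>R A, \<eta> + sm *\<^sub>R A} < \<epsilon>"
proof -
  let ?l = "range (\<lambda>\<sigma>. \<eta> + \<sigma> *\<^sub>R A)"
  let ?P = "{\<eta> + sp *\<^sub>R A, \<eta> + sm *\<^sub>R A}"
  let ?C = "sphere 0 1 \<inter> {\<xi>. \<epsilon> \<le> infdist \<xi> ?P}"
  have "?l = (+) \<eta> ` span {A}" by (auto simp: span_singleton)
  then have cl: "closed ?l" by (simp add: closed_translation closed_subspace)
  have "compact ?C"
    by (intro compact_Int_closed compact_sphere closed_Collect_le continuous_intros)
  moreover have "?C \<inter> ?l = {}" using roots assms(2) by auto
  ultimately obtain d where d: "d > 0" "\<And>x y. x \<in> ?C \<Longrightarrow> y \<in> ?l \<Longrightarrow> d \<le> dist x y"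
    using separate_compact_closed[OF _ cl] by metis
  show thesis
  proof (rule that)
    show "d / 2 > 0" using d by simp
    fix \<xi> assume \<xi>: "norm \<xi> = 1" "infdist \<xi> ?l \<le> d / 2"
    obtain y where "y \<in> ?l" "infdist \<xi> ?l = dist \<xi> y"
      using infdist_attains_inf[OF cl] by blast
    with d \<xi> have "\<xi> \<notin> ?C" by force
    with \<xi>(1) show "infdist \<xi> ?P < \<epsilon>" by auto
  qed
qed

theorem theorem1p4:
  fixes \<Omega> :: "(real^'n) set"
    and L \<eta> :: "real^'n^'m"
    and \<gamma> a :: "real^'m"
    and b :: "real^'n"
    and \<epsilon> t :: real
    and v :: "real^'n \<Rightarrow> real^'m"
  assumes "CARD('m) \<ge> 2" and "CARD('n) \<ge> 2"
    and "bounded_domain \<Omega>" and "lipschitz_boundary \<Omega>"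
    and "L \<noteq> 0"
    and "norm \<eta> < 1"
    and "a \<noteq> 0" and "L *v b \<noteq> 0"
    and "lin_fun L (tensor a b) = 0"
    and "\<epsilon> > 0"
    and "v = (\<lambda>x. \<eta> *v x + \<gamma>)"
    and "t = lin_fun L \<eta>"
  shows "\<exists>sp sm. sp > 0 \<and> 0 > sm \<and>
    (\<forall>s. norm (\<eta> + s *\<^sub>R tensor a b) = 1 \<longleftrightarrow> s = sp \<or> s = sm) \<and>
    infinite ({u \<in> W1_inf \<Omega>.
       (\<exists>G. weak_gradient \<Omega> u G \<and>
          (AE x in lebesgue_on \<Omega>. norm (G x) = 1) \<and>
          (AE x in lebesgue_on \<Omega>. lin_fun L (G x) = t) \<and>
          (AE x in lebesgue_on \<Omega>.
             infdist (G x) {\<eta> + sp *\<^sub>R tensor a b, \<eta> + sm *\<^sub>R tensor a b} < \<epsilon>)) \<and>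
       eq_on_boundary \<Omega> u v \<and>
       Linf_norm \<Omega> (\<lambda>x. u x - v x) < ereal \<epsilon>} // ae_equal \<Omega>)"
proof -
  let ?A = "tensor a b"
  have \<Omega>: "open \<Omega>" "bounded \<Omega>" "\<Omega> \<noteq> {}" using assms(3) by (auto simp: bounded_domain_def)
  interpret rank_one_direction \<Omega> L \<eta> a b
    using assms \<Omega> by unfold_locales
  obtain sp sm where s: "sp > 0" "sm < 0" "\<And>s. norm (\<eta> + s *\<^sub>R ?A) = 1 \<longleftrightarrow> s = sp \<or> s = sm"
    using unit_sphere_line_roots[OF norm_\<eta>, of ?A] norm_ab_pos by (metis norm_zero less_irrefl)
  obtain d where d: "d > 0" "\<And>\<xi>. norm \<xi> = 1 \<Longrightarrow> infdist \<xi> (range (\<lambda>\<sigma>. \<eta> + \<sigma> *\<^sub>R ?A)) \<le> d \<Longrightarrow>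
      infdist \<xi> {\<eta> + sp *\<^sub>R ?A, \<eta> + sm *\<^sub>R ?A} < \<epsilon>"
    by (rule near_line_and_sphere[OF s(3) assms(10)]) (rule that; assumption)
  obtain f x0 where f: "f \<in> Cc_inf \<Omega>" and x0: "x0 \<in> \<Omega>" "potential f x0 \<noteq> 0"
    using potential_nonzero[OF \<Omega>(3)] by blast
  let ?z = "potential f"
  have z: "?z \<in> Cc_inf \<Omega>" by (rule Cc_inf_potential[OF f])
  have sz: "smooth ?z" by (rule Cc_inf_imp_smooth[OF z])
  obtain B where B: "B \<ge> 0" "\<And>x. norm (?z x) \<le> B" using Cc_inf_bounded[OF z] by metis
  obtain D where D: "D \<ge> 0" "\<And>x. norm (jacobian ?z (at x)) \<le> D"
    using Cc_inf_bounded[OF Cc_inf_jacobian[OF z]] by metis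
  \<comment> \<open>The divisor 1 + B + D makes both \<kappa> B and \<kappa> D smaller than the
    minimum. They use half of the line tolerance d and a quarter of \<epsilon>, leaving the
    remainder to \<tau>; the third bound makes the start admissible.\<close>
  define \<kappa> where "\<kappa> = min (min (d / 2) (\<epsilon> / 4)) ((1 - norm \<eta>) / 2) / (1 + B + D)"
  have \<kappa>: "\<kappa> > 0" "\<kappa> * D \<le> d / 2" "\<kappa> * D < 1 - norm \<eta>" "\<kappa> * B \<le> \<epsilon> / 4"
  proof -
    let ?m = "min (min (d / 2) (\<epsilon> / 4)) ((1 - norm \<eta>) / 2)"
    have m: "?m > 0" using d(1) assms(10) norm_\<eta> by simp
    then show k: "\<kappa> > 0" using B(1) D(1) by (simp add: \<kappa>_def)
    have "\<kappa> * (1 + B + D) = ?m" using B(1) D(1) by (simp add: \<kappa>_def)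
    moreover have "\<kappa> * (1 + B + D) = \<kappa> + \<kappa> * B + \<kappa> * D" by (simp add: algebra_simps)
    moreover have "\<kappa> * B \<ge> 0" "\<kappa> * D \<ge> 0" using k B(1) D(1) by simp_all
    ultimately have "\<kappa> * B < ?m" "\<kappa> * D < ?m" using k by linarith+
    then show "\<kappa> * D \<le> d / 2" "\<kappa> * D < 1 - norm \<eta>" "\<kappa> * B \<le> \<epsilon> / 4" using norm_\<eta> by auto
  qed
  define c where "c i = \<kappa> * (1/2) ^ i" for i :: nat
  have c: "0 < c i" "c i \<le> \<kappa>" for i
    using \<kappa>(1) by (auto simp: c_def power_le_one)
  \<comment> \<open>Starting values at x0 for i < j differ by at least c i / 2 times |z(x0)|, as c
    at least halves. With the divisor 8 the two errors sum to at most 3/16 of c i |z(x0)|, so the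
    values of the solutions remain distinct.\<close>
  define \<tau> where "\<tau> i = min (min (d / 2) (\<epsilon> / 4)) (c i * norm (?z x0) / 8)" for i
  have \<tau>: "\<tau> i > 0" "\<tau> i \<le> d / 2" "\<tau> i \<le> \<epsilon> / 4" "\<tau> i \<le> c i * norm (?z x0) / 8" for i
    using d(1) assms(10) c x0(2) by (auto simp: \<tau>_def)
  let ?S = "{u \<in> W1_inf \<Omega>.
       (\<exists>G. weak_gradient \<Omega> u G \<and>
          (AE x in lebesgue_on \<Omega>. norm (G x) = 1) \<and>
          (AE x in lebesgue_on \<Omega>. lin_fun L (G x) = t) \<and>
          (AE x in lebesgue_on \<Omega>.
             infdist (G x) {\<eta> + sp *\<^sub>R tensor a b, \<eta> + sm *\<^sub>R tensor a b} < \<epsilon>)) \<and>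
       eq_on_boundary \<Omega> u v \<and>
       Linf_norm \<Omega> (\<lambda>x. u x - v x) < ereal \<epsilon>}"
  have "\<forall>i. \<exists>u. u \<in> ?S \<and> continuous_on UNIV u \<and> norm (u x0 - v x0 - c i *\<^sub>R ?z x0) \<le> \<tau> i"
  proof
    fix i
    let ?w = "\<lambda>x. c i *\<^sub>R ?z x"
    have J: "jacobian ?w (at x) = c i *\<^sub>R jacobian ?z (at x)" for x
      using jacobian_scaleR[OF sz] .
    have JD: "norm (jacobian ?w (at x)) \<le> \<kappa> * D" for x
      unfolding J norm_scaleR using c[of i] D \<kappa>(1) by (intro mult_mono) auto
    have adm: "admissible ?w"
      unfolding admissible_def
    proof (intro conjI allI)
      show "?w \<in> Cc_inf \<Omega>" by (rule Cc_inf_scaleR_left[OF z])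
      show "norm (\<eta> + jacobian ?w (at x)) < 1" for x
        using norm_triangle_ineq[of \<eta> "jacobian ?w (at x)"] JD[of x] \<kappa>(3) by linarith
      show "lin_fun L (jacobian ?w (at x)) = 0" for x
        using lin_fun_potential[OF Cc_inf_imp_smooth[OF f], of x]
        unfolding J lin_fun_eq_inner inner_scaleR_right by simp
    qed
    have wB: "norm (?w x) \<le> \<kappa> * B" for x
      unfolding norm_scaleR using c[of i] B \<kappa>(1) by (intro mult_mono) auto
    obtain u G where u: "continuous_on UNIV u" "\<And>x. norm (u x - (\<eta> *v x + \<gamma>) - ?w x) \<le> \<tau> i"
      "u \<in> W1_inf \<Omega>" "weak_gradient \<Omega> u G" "eq_on_boundary \<Omega> u (\<lambda>x. \<eta> *v x + \<gamma>)"
      "Linf_norm \<Omega> (\<lambda>x. u x - (\<eta> *v x + \<gamma>)) \<le> ereal (\<kappa> * B + \<tau> i)"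
      and G: "AE x in lebesgue_on \<Omega>. norm (G x) = 1"
      "AE x in lebesgue_on \<Omega>. lin_fun L (G x) = lin_fun L \<eta>"
      "AE x in lebesgue_on \<Omega>. infdist (G x) (range (\<lambda>\<sigma>. \<eta> + \<sigma> *\<^sub>R ?A)) \<le> \<kappa> * D + \<tau> i"
      by (rule exact_solution[OF adm \<tau>(1) \<Omega>(3) JD wB]) (rule that; assumption)
    have "AE x in lebesgue_on \<Omega>. infdist (G x) {\<eta> + sp *\<^sub>R ?A, \<eta> + sm *\<^sub>R ?A} < \<epsilon>"
      using G(1,3)
    proof eventually_elim
      case (elim x)
      then show ?case using \<kappa>(2) \<tau>(2)[of i] by (intro d(2)) linarith+
    qed
    moreover have "Linf_norm \<Omega> (\<lambda>x. u x - v x) < ereal \<epsilon>"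
      unfolding assms(11) using \<kappa>(4) \<tau>(3)[of i] assms(10) by (intro le_less_trans[OF u(6)]) simp
    ultimately have "u \<in> ?S" using u(3-5) G(1,2) unfolding assms(11,12) by blast
    then show "\<exists>u. u \<in> ?S \<and> continuous_on UNIV u \<and> norm (u x0 - v x0 - c i *\<^sub>R ?z x0) \<le> \<tau> i"
      using u(1,2) unfolding assms(11) by blast
  qed
  from choice[OF this] obtain u where uS: "\<forall>i. u i \<in> ?S \<and> continuous_on UNIV (u i) \<and>
    norm (u i x0 - v x0 - c i *\<^sub>R ?z x0) \<le> \<tau> i"
    by (rule exE)
  have u: "u i \<in> ?S" "continuous_on UNIV (u i)" "norm (u i x0 - v x0 - c i *\<^sub>R ?z x0) \<le> \<tau> i" for i
    by (rule conjunct1[OF uS[rule_format]], rule conjunct1[OF conjunct2[OF uS[rule_format]]],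
        rule conjunct2[OF conjunct2[OF uS[rule_format]]])
  have less: "u i x0 \<noteq> u j x0" if "i < j" for i j
  proof
    assume eq: "u i x0 = u j x0"
    have "(1/2::real) ^ j \<le> (1/2) ^ Suc i" using that by (intro power_decreasing) auto
    then have cj: "c j \<le> c i / 2" using \<kappa>(1) by (simp add: c_def)
    have n: "norm (?z x0) > 0" using x0(2) by simp
    have "(c i - c j) *\<^sub>R ?z x0 = (u j x0 - v x0 - c j *\<^sub>R ?z x0) - (u i x0 - v x0 - c i *\<^sub>R ?z x0)"
      using eq by (simp add: algebra_simps)
    then have "norm ((c i - c j) *\<^sub>R ?z x0) \<le> \<tau> j + \<tau> i"
      using norm_triangle_ineq4[of "u j x0 - v x0 - c j *\<^sub>R ?z x0" "u i x0 - v x0 - c i *\<^sub>R ?z x0"]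
        u(3)[of i] u(3)[of j] by simp
    also have "\<dots> \<le> (c i / 4) * norm (?z x0)"
      using \<tau>(4)[of i] \<tau>(4)[of j] mult_right_mono[OF cj norm_ge_zero[of "?z x0"]]
        mult_pos_pos[OF c(1)[of i] n] unfolding times_divide_eq_left by linarith
    finally have "(c i - c j) * norm (?z x0) \<le> (c i / 4) * norm (?z x0)" using cj c(1)[of i] by simp
    then have "c i - c j \<le> c i / 4" using n by (simp only: mult_le_cancel_right_pos)
    then show False using cj c(1)[of i] by simp
  qed
  \<comment> \<open>Distinct values at x0 separate the classes because all solutions are continuous
    and x0 lies in the open set \<Omega>.\<close>
  have "inj (\<lambda>i. ae_equal \<Omega> `` {u i})"
  proof (rule injI)
    fix i j assume "ae_equal \<Omega> `` {u i} = ae_equal \<Omega> `` {u j}"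
    moreover have "u j \<in> ae_equal \<Omega> `` {u j}" by (simp add: ae_equal_def)
    ultimately have "u j \<in> ae_equal \<Omega> `` {u i}" by simp
    then have "AE x in lebesgue_on \<Omega>. u i x = u j x" by (simp add: ae_equal_def)
    then have "u i x0 = u j x0"
      by (rule AE_lebesgue_on_eq_imp_eq[OF \<Omega>(1) u(2) u(2) _ x0(1)])
    then show "i = j" using less[of i j] less[of j i] by (metis linorder_neqE_nat)
  qed
  then have "infinite (range (\<lambda>i. ae_equal \<Omega> `` {u i}))" by (rule range_inj_infinite)
  moreover have "range (\<lambda>i. ae_equal \<Omega> `` {u i}) \<subseteq> ?S // ae_equal \<Omega>"
    using quotientI[OF u(1)] by blast
  ultimately have "infinite (?S // ae_equal \<Omega>)" by (rule infinite_super[rotated])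
  with s show ?thesis by (intro exI[of _ sp] exI[of _ sm] conjI allI)
qed

end
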